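(* Let $A$ be a commutative ring and let $\mathfrak{a}$ be an ideal in $A$. If the ideal $\mathfrak{a}$ is finitely generated, then every $\mathfrak{a}$-adic system $\{ M_k \}_{k \in \mathbb{N}}$ of $A$-modules is induced from a module; i.e. there is an $A$-module $M$ such that $\{M_k\}_{k\in\mathbb{N}}$ is isomorphic, as an $\mathfrak{a}$-adic system, to $\{A_k \otimes_A M\}_{k \in \mathbb{N}}$.
   Context: Here $A_k := A/\mathfrak{a}^{k+1}$ for $k \in \mathbb{N} = \{0,1,2,\ldots\}$. An $\mathfrak{a}$-adic system of $A$-modules is an inverse system $\{M_k\}_{k\in\mathbb{N}}$, where each $M_k$ is an $A_k$-module, with $A$-module homomorphisms (transitions) $M_{k+1} \to M_k$ such that for every $k$ the induced homomorphism $A_k \otimes_{A_{k+1}} M_{k+1} \to M_k$ is bijective. A morphism of $\mathfrak{a}$-adic systems $\{M_k\} \to \{N_k\}$ is a collection of $A$-module homomorphisms $M_k \to N_k$ commuting with the transitions. The $\mathfrak{a}$-adic system induced by an $A$-module $M$ is $\{A_k \otimes_A M\}_{k\in\mathbb{N}}$ with the obvious transitions. *)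

theory Defs
  imports "HOL-Algebra.QuotRing" "HOL-Algebra.Ideal_Product" "HOL-Algebra.Module"
    "HOL-Algebra.Generated_Groups" "HOL-Algebra.Free_Abelian_Groups"
begin

section \<open>Module homomorphisms and restriction of scalars\<close>

definition module_hom ::
    "('r, 'x) ring_scheme \<Rightarrow> ('r, 'm, 'y) module_scheme \<Rightarrow> ('r, 'n, 'z) module_scheme
      \<Rightarrow> ('m \<Rightarrow> 'n) set"
  where "module_hom R M N = {f \<in> hom (add_monoid M) (add_monoid N).
    \<forall>r\<in>carrier R. \<forall>x\<in>carrier M. f (r \<odot>\<^bsub>M\<^esub> x) = r \<odot>\<^bsub>N\<^esub> f x}"

definition regular_module :: "('s, 'x) ring_scheme \<Rightarrow> ('s, 's) module"
  where "regular_module S = \<lparr>carrier = carrier S, monoid.mult = monoid.mult S, one = one S,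
    ring.zero = ring.zero S, add = add S, smult = monoid.mult S\<rparr>"

definition restrict_scalars ::
    "('r \<Rightarrow> 's) \<Rightarrow> ('s, 'm, 'y) module_scheme \<Rightarrow> ('r, 'm) module"
  where "restrict_scalars \<phi> M = \<lparr>carrier = carrier M, monoid.mult = monoid.mult M, one = one M,
    ring.zero = ring.zero M, add = add M, smult = (\<lambda>r x. \<phi> r \<odot>\<^bsub>M\<^esub> x)\<rparr>"


section \<open>Tensor products\<close>

abbreviation tensor_free ::
    "('r, 'm, 'y) module_scheme \<Rightarrow> ('r, 'n, 'z) module_scheme \<Rightarrow> ('m \<times> 'n \<Rightarrow>\<^sub>0 int) monoid"
  where "tensor_free M N \<equiv> free_Abelian_group (carrier M \<times> carrier N)"

definition tensor_relations ::
    "('r, 'x) ring_scheme \<Rightarrow> ('r, 'm, 'y) module_scheme \<Rightarrow> ('r, 'n, 'z) module_scheme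
      \<Rightarrow> ('m \<times> 'n \<Rightarrow>\<^sub>0 int) set"
  where "tensor_relations R M N = generate (tensor_free M N)
    ({frag_of (x \<oplus>\<^bsub>M\<^esub> x', y) - frag_of (x, y) - frag_of (x', y) | x x' y.
        x \<in> carrier M \<and> x' \<in> carrier M \<and> y \<in> carrier N} \<union>
     {frag_of (x, y \<oplus>\<^bsub>N\<^esub> y') - frag_of (x, y) - frag_of (x, y') | x y y'.
        x \<in> carrier M \<and> y \<in> carrier N \<and> y' \<in> carrier N} \<union>
     {frag_of (r \<odot>\<^bsub>M\<^esub> x, y) - frag_of (x, r \<odot>\<^bsub>N\<^esub> y) | r x y.
        r \<in> carrier R \<and> x \<in> carrier M \<and> y \<in> carrier N})"

definition tensor_group ::
    "('r, 'x) ring_scheme \<Rightarrow> ('r, 'm, 'y) module_scheme \<Rightarrow> ('r, 'n, 'z) module_scheme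
      \<Rightarrow> ('m \<times> 'n \<Rightarrow>\<^sub>0 int) set monoid"
  where "tensor_group R M N = tensor_free M N Mod tensor_relations R M N"

text \<open>The map \<open>f \<otimes> g\<close> into the tensor product of \<open>M'\<close> and \<open>N'\<close>; on a coset \<open>X\<close> all members of
  the union coincide whenever \<open>f\<close> and \<open>g\<close> are \<open>R\<close>-linear.\<close>

definition tensor_map ::
    "('r, 'x) ring_scheme \<Rightarrow> ('r, 'm, 'y) module_scheme \<Rightarrow> ('r, 'n, 'z) module_scheme
      \<Rightarrow> ('p \<Rightarrow> 'm) \<Rightarrow> ('q \<Rightarrow> 'n) \<Rightarrow> ('p \<times> 'q \<Rightarrow>\<^sub>0 int) set \<Rightarrow> ('m \<times> 'n \<Rightarrow>\<^sub>0 int) set"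
  where "tensor_map R M' N' f g X = (\<Union>c\<in>X. tensor_relations R M' N'
    #>\<^bsub>tensor_free M' N'\<^esub> frag_extend (\<lambda>(x, y). frag_of (f x, g y)) c)"

text \<open>The additive map out of a tensor product that sends \<open>x \<otimes> y\<close> to \<open>\<beta> (x, y)\<close>, for balanced
  biadditive \<open>\<beta>\<close> (\<open>the_elem\<close> as in the first isomorphism theorem of HOL-Algebra).\<close>

definition tensor_lift ::
    "('t, 'x) ring_scheme \<Rightarrow> ('m \<times> 'n \<Rightarrow> 't) \<Rightarrow> ('m \<times> 'n \<Rightarrow>\<^sub>0 int) set \<Rightarrow> 't"
  where "tensor_lift T \<beta> X = the_elem
    ((\<lambda>c. \<Oplus>\<^bsub>T\<^esub>p\<in>Poly_Mapping.keys c. add_pow T (Poly_Mapping.lookup c p) (\<beta> p)) ` X)"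

text \<open>\<open>S \<otimes>\<^sub>R N\<close> as an \<open>S\<close>-module, for a ring homomorphism \<open>\<phi>\<close> from \<open>R\<close> to \<open>S\<close>; the fields
  \<open>mult\<close> and \<open>one\<close> of the record are irrelevant for modules.\<close>

definition base_change ::
    "('r, 'x) ring_scheme \<Rightarrow> ('s, 'y) ring_scheme \<Rightarrow> ('r \<Rightarrow> 's) \<Rightarrow> ('r, 'n, 'z) module_scheme
      \<Rightarrow> ('s, ('s \<times> 'n \<Rightarrow>\<^sub>0 int) set) module"
  where "base_change R S \<phi> N =
    (let S' = restrict_scalars \<phi> (regular_module S); G = tensor_group R S' N
     in \<lparr>carrier = carrier G, monoid.mult = undefined, one = undefined, ring.zero = one G, add = monoid.mult G,
         smult = (\<lambda>s. tensor_map R S' N (\<lambda>t. s \<otimes>\<^bsub>S\<^esub> t) (\<lambda>y. y))\<rparr>)"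


section \<open>Adic systems\<close>

definition adic_power :: "('a, 'x) ring_scheme \<Rightarrow> 'a set \<Rightarrow> nat \<Rightarrow> 'a set"
  where "adic_power R I k = I [^]\<^bsub>ideals_set R\<^esub> Suc k"

definition adic_ring :: "('a, 'x) ring_scheme \<Rightarrow> 'a set \<Rightarrow> nat \<Rightarrow> 'a set ring"
  where "adic_ring R I k = R Quot adic_power R I k"

definition adic_proj :: "('a, 'x) ring_scheme \<Rightarrow> 'a set \<Rightarrow> nat \<Rightarrow> 'a \<Rightarrow> 'a set"
  where "adic_proj R I k r = adic_power R I k +>\<^bsub>R\<^esub> r"

text \<open>The projection from \<open>adic_ring R I (Suc k)\<close> to \<open>adic_ring R I k\<close>, sending the coset of \<open>r\<close>
  to the coset of \<open>r\<close>.\<close>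

definition adic_ring_trans :: "('a, 'x) ring_scheme \<Rightarrow> 'a set \<Rightarrow> nat \<Rightarrow> 'a set \<Rightarrow> 'a set"
  where "adic_ring_trans R I k X = (\<Union>r\<in>X. adic_power R I k +>\<^bsub>R\<^esub> r)"

text \<open>\<open>\<tau> k\<close> is the transition from \<open>M (Suc k)\<close> to \<open>M k\<close>. The last clause says that
  \<open>a \<otimes> x \<mapsto> a \<cdot> \<tau> k x\<close> is a bijection from the base change of \<open>M (Suc k)\<close> onto \<open>M k\<close>.\<close>

definition adic_system ::
    "('a, 'x) ring_scheme \<Rightarrow> 'a set \<Rightarrow> (nat \<Rightarrow> ('a set, 'm) module) \<Rightarrow> (nat \<Rightarrow> 'm \<Rightarrow> 'm) \<Rightarrow> bool"
  where "adic_system R I M \<tau> \<longleftrightarrow> (\<forall>k.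
    module (adic_ring R I k) (M k) \<and>
    \<tau> k \<in> module_hom R (restrict_scalars (adic_proj R I (Suc k)) (M (Suc k)))
                       (restrict_scalars (adic_proj R I k) (M k)) \<and>
    bij_betw (tensor_lift (M k) (\<lambda>(a, x). a \<odot>\<^bsub>M k\<^esub> \<tau> k x))
      (carrier (base_change (adic_ring R I (Suc k)) (adic_ring R I k)
        (adic_ring_trans R I k) (M (Suc k))))
      (carrier (M k)))"

definition adic_morphism ::
    "('a, 'x) ring_scheme \<Rightarrow> 'a set \<Rightarrow> (nat \<Rightarrow> ('a set, 'm) module) \<Rightarrow> (nat \<Rightarrow> 'm \<Rightarrow> 'm)
      \<Rightarrow> (nat \<Rightarrow> ('a set, 'n) module) \<Rightarrow> (nat \<Rightarrow> 'n \<Rightarrow> 'n) \<Rightarrow> (nat \<Rightarrow> 'm \<Rightarrow> 'n) \<Rightarrow> bool"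
  where "adic_morphism R I M \<tau> N \<sigma> f \<longleftrightarrow> (\<forall>k.
    f k \<in> module_hom R (restrict_scalars (adic_proj R I k) (M k))
                       (restrict_scalars (adic_proj R I k) (N k)) \<and>
    (\<forall>x\<in>carrier (M (Suc k)). f k (\<tau> k x) = \<sigma> k (f (Suc k) x)))"

definition adic_isomorphic ::
    "('a, 'x) ring_scheme \<Rightarrow> 'a set \<Rightarrow> (nat \<Rightarrow> ('a set, 'm) module) \<Rightarrow> (nat \<Rightarrow> 'm \<Rightarrow> 'm)
      \<Rightarrow> (nat \<Rightarrow> ('a set, 'n) module) \<Rightarrow> (nat \<Rightarrow> 'n \<Rightarrow> 'n) \<Rightarrow> bool"
  where "adic_isomorphic R I M \<tau> N \<sigma> \<longleftrightarrow> (\<exists>f g.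
    adic_morphism R I M \<tau> N \<sigma> f \<and> adic_morphism R I N \<sigma> M \<tau> g \<and>
    (\<forall>k. (\<forall>x\<in>carrier (M k). g k (f k x) = x) \<and> (\<forall>y\<in>carrier (N k). f k (g k y) = y)))"

definition induced_system ::
    "('a, 'x) ring_scheme \<Rightarrow> 'a set \<Rightarrow> ('a, 'n) module
      \<Rightarrow> nat \<Rightarrow> ('a set, ('a set \<times> 'n \<Rightarrow>\<^sub>0 int) set) module"
  where "induced_system R I N k = base_change R (adic_ring R I k) (adic_proj R I k) N"

definition induced_trans ::
    "('a, 'x) ring_scheme \<Rightarrow> 'a set \<Rightarrow> ('a, 'n) module
      \<Rightarrow> nat \<Rightarrow> ('a set \<times> 'n \<Rightarrow>\<^sub>0 int) set \<Rightarrow> ('a set \<times> 'n \<Rightarrow>\<^sub>0 int) set"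
  where "induced_trans R I N k =
    tensor_map R (restrict_scalars (adic_proj R I k) (regular_module (adic_ring R I k))) N
      (adic_ring_trans R I k) (\<lambda>y. y)"

end

theory Submission
  imports Defs
begin

text \<open>The module is the limit \<open>N\<close> of the system: compatible sequences \<open>(x\<^sub>0, x\<^sub>1, \<dots>)\<close> with \<open>x\<^sub>k\<close> in
\<open>M\<^sub>k\<close>. Write \<open>I\<close> for the ideal and \<open>A\<^sub>k = R / I\<^bsup>k+1\<^esup>\<close>. The base change of a module \<open>X\<close> along a
surjective ring homomorphism with kernel \<open>J\<close> is \<open>X / JX\<close>, with \<open>1 \<otimes> x\<close> corresponding to the class
of \<open>x\<close> (\<open>carrier_base_change\<close> and \<open>one_tensor_eq_iff_kernel\<close>). This fact is used twice.

Applied to \<open>A\<^sub>k\<^sub>+\<^sub>1 \<rightarrow> A\<^sub>k\<close>, it turns the bijectivity condition on an adic system into a statement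
without tensor products: each transition \<open>M\<^sub>k\<^sub>+\<^sub>1 \<rightarrow> M\<^sub>k\<close> is surjective with kernel
\<open>I\<^bsup>k+1\<^esup> M\<^sub>k\<^sub>+\<^sub>1\<close> (\<open>adic_system_tower\<close>). Applied to \<open>R \<rightarrow> A\<^sub>k\<close>, it identifies \<open>A\<^sub>k \<otimes> N\<close> with
\<open>N / I\<^bsup>k+1\<^esup> N\<close>. So what has to be shown is that the projection \<open>N \<rightarrow> M\<^sub>k\<close> is surjective, which
follows by lifting one level at a time, and that its kernel \<open>K\<^sub>k\<close> is exactly \<open>I\<^bsup>k+1\<^esup> N\<close>.

The inclusion \<open>K\<^sub>k \<subseteq> I\<^bsup>k+1\<^esup> N\<close> (\<open>component_kernel\<close>) is the heart of the matter and the place where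
finite generation is needed. Let \<open>G\<close> be a finite set of generators of \<open>I\<^bsup>k+1\<^esup>\<close>. An element of
\<open>K\<^bsub>k+i\<^esub>\<close> has its component at level \<open>k+i+1\<close> in \<open>I\<^bsup>k+i+1\<^esup> M\<^bsub>k+i+1\<^esub>\<close>, hence agrees up to
\<open>K\<^bsub>k+i+1\<^esub>\<close> with some \<open>\<Sum>\<^bsub>g\<in>G\<^esub> g v\<^sub>g\<close> where \<open>v\<^sub>g\<close> lies in \<open>I\<^sup>i N\<close> (\<open>approximation_step\<close>). Repeating
this from \<open>x\<close> in \<open>K\<^sub>k\<close> yields, for each \<open>g\<close>, corrections lying in \<open>I\<^sup>0 N, I\<^sup>1 N, I\<^sup>2 N, \<dots>\<close>. Only
finitely many of them affect a given component, so they can be summed up in \<open>N\<close> to some \<open>y\<^sub>g\<close>, and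
\<open>x = \<Sum>\<^bsub>g\<in>G\<^esub> g y\<^sub>g\<close>. Without a finite \<open>G\<close> chosen in advance the successive corrections would involve
ever more coefficients, and the limit would not be a finite sum.\<close>

section \<open>Submodules of the form \<open>JP\<close>\<close>

lemma (in abelian_group) minus_zero_right: "x \<in> carrier G \<Longrightarrow> x \<ominus> \<zero> = x"
  using r_neg[of \<zero>] l_zero[of "\<ominus> \<zero>"] by (simp add: a_minus_def)

lemma (in abelian_group) minus_eq_zero_iff:
  assumes "x \<in> carrier G" and "y \<in> carrier G"
  shows "x \<ominus> y = \<zero> \<longleftrightarrow> x = y"
proof
  assume "x \<ominus> y = \<zero>"
  moreover have "x = (x \<ominus> y) \<oplus> y"
    using assms by (simp add: a_minus_def a_assoc l_neg)
  ultimately show "x = y" using assms by simp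
qed (use assms in \<open>simp add: a_minus_def r_neg\<close>)

text \<open>For an ideal \<open>J\<close> and a submodule \<open>P\<close> this is the submodule \<open>JP\<close>. It is generated
as an additive group from a bare set of scalars, so that it can be compared across a restriction of
scalars, under which \<open>J\<close> changes but the products do not.\<close>

definition smult_span ::
    "('r, 'm, 'y) module_scheme \<Rightarrow> 'r set \<Rightarrow> 'm set \<Rightarrow> 'm set"
  where "smult_span M J P = generate (add_monoid M) {r \<odot>\<^bsub>M\<^esub> x | r x. r \<in> J \<and> x \<in> P}"

text \<open>The additive monoids of a module and of its restriction of scalars have the same operations, but they
are records of different types; this lemma carries generated subgroups from one to the other.\<close>

lemma generate_cong:
  assumes "carrier G = carrier H" and "monoid.mult G = monoid.mult H" and "\<one>\<^bsub>G\<^esub> = \<one>\<^bsub>H\<^esub>"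
  shows "generate G K = generate H K"
proof -
  have inv: "inv\<^bsub>G\<^esub> x = inv\<^bsub>H\<^esub> x" for x
    unfolding m_inv_def using assms by simp
  have "x \<in> generate H K" if "x \<in> generate G K" for x
    using that
    by (induction rule: generate.induct)
      (simp_all add: assms inv generate.one generate.incl generate.inv generate.eng)
  moreover have "x \<in> generate G K" if "x \<in> generate H K" for x
    using that
    by (induction rule: generate.induct)
      (simp_all add: assms(2,3)[symmetric] inv[symmetric] generate.one generate.incl generate.inv generate.eng)
  ultimately show ?thesis by blast
qed

context module
begin

lemma smult_span_gen: "r \<in> J \<Longrightarrow> x \<in> P \<Longrightarrow> r \<odot>\<^bsub>M\<^esub> x \<in> smult_span M J P"
  unfolding smult_span_def by (intro generate.incl) blast

lemma smult_span_subgroup: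
  "J \<subseteq> carrier R \<Longrightarrow> P \<subseteq> carrier M \<Longrightarrow> subgroup (smult_span M J P) (add_monoid M)"
  unfolding smult_span_def by (rule M.add.generate_is_subgroup) auto

lemma smult_span_subset_carrier:
  "J \<subseteq> carrier R \<Longrightarrow> P \<subseteq> carrier M \<Longrightarrow> smult_span M J P \<subseteq> carrier M"
  using subgroup.subset[OF smult_span_subgroup] by simp

lemma smult_span_minimal:
  assumes "subgroup H (add_monoid M)"
    and "\<And>r x. r \<in> J \<Longrightarrow> x \<in> P \<Longrightarrow> r \<odot>\<^bsub>M\<^esub> x \<in> H"
  shows "smult_span M J P \<subseteq> H"
  unfolding smult_span_def
  by (rule M.add.generate_subgroup_incl[OF _ assms(1)]) (use assms(2) in blast)

lemma smult_span_submodule: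
  assumes J: "J \<subseteq> carrier R" and P: "submodule P R M"
  shows "submodule (smult_span M J P) R M"
proof -
  note PM = submoduleE(1)[OF P]
  note S = smult_span_subgroup[OF J PM]
  interpret S: subgroup "smult_span M J P" "add_monoid M" by (rule S)
  have "a \<odot>\<^bsub>M\<^esub> x \<in> smult_span M J P" if a: "a \<in> carrier R" and x: "x \<in> smult_span M J P" for a x
  proof -
    let ?H = "{x \<in> carrier M. a \<odot>\<^bsub>M\<^esub> x \<in> smult_span M J P}"
    have "subgroup ?H (add_monoid M)"
      using a S.m_closed S.m_inv_closed S.one_closed
      by (intro M.add.subgroupI) (auto simp: smult_r_distr smult_r_minus a_inv_def[symmetric])
    moreover have "r \<odot>\<^bsub>M\<^esub> x \<in> ?H" if "r \<in> J" "x \<in> P" for r x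
    proof -
      have "r \<in> carrier R" "x \<in> carrier M" using that J PM by auto
      then have "a \<odot>\<^bsub>M\<^esub> (r \<odot>\<^bsub>M\<^esub> x) = r \<odot>\<^bsub>M\<^esub> (a \<odot>\<^bsub>M\<^esub> x)"
        using a by (metis R.m_comm smult_assoc1)
      then show ?thesis
        using that a \<open>r \<in> carrier R\<close> \<open>x \<in> carrier M\<close> smult_span_gen[OF that(1) submoduleE(4)[OF P a that(2)]]
        by auto
    qed
    ultimately have "smult_span M J P \<subseteq> ?H" by (rule smult_span_minimal)
    then show ?thesis using x by blast
  qed
  then show ?thesis by (intro submodule.intro S submodule_axioms.intro)
qed

text \<open>The elements of the asserted form make up a submodule \<open>T\<close>, and the scalars \<open>r\<close> with \<open>rP \<subseteq> T\<close> make up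
an ideal. That ideal contains \<open>G\<close>, hence \<open>Idl G\<close>. The point of the conclusion is that the index set of
the sum is \<open>G\<close> itself, the same for all elements.\<close>

lemma smult_span_finite_generators:
  assumes G: "finite G" "G \<subseteq> carrier R" and P: "submodule P R M"
    and z: "z \<in> smult_span M (Idl\<^bsub>R\<^esub> G) P"
  shows "\<exists>y. (\<forall>g\<in>G. y g \<in> P) \<and> z = (\<Oplus>\<^bsub>M\<^esub>g\<in>G. g \<odot>\<^bsub>M\<^esub> y g)"
proof -
  note PM = submoduleE(1)[OF P]
  interpret P: submodule P R M by (rule P)
  let ?s = "\<lambda>y. \<Oplus>\<^bsub>M\<^esub>g\<in>G. g \<odot>\<^bsub>M\<^esub> y g"
  define T where "T = {?s y | y. \<forall>g\<in>G. y g \<in> P}"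
  have TI: "?s y \<in> T" if "\<forall>g\<in>G. y g \<in> P" for y
    using that unfolding T_def by blast
  have TE: "\<exists>y. (\<forall>g\<in>G. y g \<in> P) \<and> z = ?s y" if "z \<in> T" for z
    using that unfolding T_def by blast
  have s_closed: "?s y \<in> carrier M" if "\<forall>g\<in>G. y g \<in> P" for y
    using that G PM by (intro M.finsum_closed) auto
  have s_add: "?s y \<oplus>\<^bsub>M\<^esub> ?s y' = ?s (\<lambda>g. y g \<oplus>\<^bsub>M\<^esub> y' g)"
    if y: "\<forall>g\<in>G. y g \<in> P" and y': "\<forall>g\<in>G. y' g \<in> P" for y y'
  proof -
    have *: "g \<in> carrier R \<and> y g \<in> carrier M \<and> y' g \<in> carrier M" if "g \<in> G" for g
      using that y y' G(2) PM by auto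
    have "?s y \<oplus>\<^bsub>M\<^esub> ?s y' = (\<Oplus>\<^bsub>M\<^esub>g\<in>G. g \<odot>\<^bsub>M\<^esub> y g \<oplus>\<^bsub>M\<^esub> g \<odot>\<^bsub>M\<^esub> y' g)"
      by (rule M.finsum_addf[symmetric]) (use * in auto)
    also have "\<dots> = ?s (\<lambda>g. y g \<oplus>\<^bsub>M\<^esub> y' g)"
      by (rule M.add.finprod_cong') (use * in \<open>auto simp: smult_r_distr\<close>)
    finally show ?thesis .
  qed
  have s_smult: "a \<odot>\<^bsub>M\<^esub> ?s y = ?s (\<lambda>g. a \<odot>\<^bsub>M\<^esub> y g)" if a: "a \<in> carrier R" and y: "\<forall>g\<in>G. y g \<in> P" for a y
  proof -
    have *: "g \<in> carrier R \<and> y g \<in> carrier M" if "g \<in> G" for g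
      using that y G(2) PM by auto
    have "a \<odot>\<^bsub>M\<^esub> ?s y = (\<Oplus>\<^bsub>M\<^esub>g\<in>G. a \<odot>\<^bsub>M\<^esub> (g \<odot>\<^bsub>M\<^esub> y g))"
      by (rule finsum_smult_ldistr) (use * a G in auto)
    also have "\<dots> = ?s (\<lambda>g. a \<odot>\<^bsub>M\<^esub> y g)"
      by (rule M.add.finprod_cong')
        (use * a in \<open>auto simp: smult_assoc1[symmetric] R.m_comm\<close>)
    finally show ?thesis .
  qed
  have T: "submodule T R M"
  proof (rule submoduleI)
    show TM: "T \<subseteq> carrier M" using s_closed unfolding T_def by blast
    have "?s (\<lambda>_. \<zero>\<^bsub>M\<^esub>) = \<zero>\<^bsub>M\<^esub>"
      using G by (subst M.add.finprod_cong'[of _ _ "\<lambda>_. \<zero>\<^bsub>M\<^esub>"]) auto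
    moreover have "\<zero>\<^bsub>M\<^esub> \<in> P" using P.one_closed by simp
    ultimately show zero: "\<zero>\<^bsub>M\<^esub> \<in> T" using TI[of "\<lambda>_. \<zero>\<^bsub>M\<^esub>"] by simp
    show add: "a \<oplus>\<^bsub>M\<^esub> b \<in> T" if "a \<in> T" "b \<in> T" for a b
    proof -
      from TE[OF that(1)] TE[OF that(2)]
      obtain y y' where "\<forall>g\<in>G. y g \<in> P" "a = ?s y" "\<forall>g\<in>G. y' g \<in> P" "b = ?s y'"
        by blast
      then show ?thesis
        using s_add[of y y'] submoduleE(5)[OF P] TI by simp
    qed
    show smult: "a \<odot>\<^bsub>M\<^esub> x \<in> T" if "a \<in> carrier R" "x \<in> T" for a x
    proof -
      from TE[OF that(2)] obtain y where "\<forall>g\<in>G. y g \<in> P" "x = ?s y"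
        by blast
      then show ?thesis
        using s_smult[OF that(1), of y] submoduleE(4)[OF P that(1)] TI by simp
    qed
    show "\<ominus>\<^bsub>M\<^esub> a \<in> T" if "a \<in> T" for a
    proof -
      have "a \<in> carrier M" using that TM by blast
      then have "\<ominus>\<^bsub>M\<^esub> a = (\<ominus> \<one>) \<odot>\<^bsub>M\<^esub> a" by (simp add: smult_l_minus)
      then show ?thesis using smult[OF _ that, of "\<ominus> \<one>"] by simp
    qed
  qed
  interpret T: submodule T R M by (rule T)
  have pure: "g \<odot>\<^bsub>M\<^esub> x \<in> T" if g: "g \<in> G" and x: "x \<in> P" for g x
  proof -
    have gx: "g \<in> carrier R" "x \<in> carrier M" using g x G(2) PM by auto
    have "?s (\<lambda>h. if h = g then x else \<zero>\<^bsub>M\<^esub>) = (\<Oplus>\<^bsub>M\<^esub>h\<in>G. if g = h then g \<odot>\<^bsub>M\<^esub> x else \<zero>\<^bsub>M\<^esub>)"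
      by (rule M.add.finprod_cong') (use gx G in auto)
    also have "\<dots> = g \<odot>\<^bsub>M\<^esub> x"
      using M.add.finprod_singleton[OF g G(1), of "\<lambda>h. g \<odot>\<^bsub>M\<^esub> x"] gx by simp
    finally have *: "g \<odot>\<^bsub>M\<^esub> x = ?s (\<lambda>h. if h = g then x else \<zero>\<^bsub>M\<^esub>)" by (rule sym)
    show ?thesis
      by (subst *) (rule TI, use x P.one_closed in simp)
  qed
  define K where "K = {r \<in> carrier R. \<forall>x\<in>P. r \<odot>\<^bsub>M\<^esub> x \<in> T}"
  have KI: "r \<in> K" if "r \<in> carrier R" "\<And>x. x \<in> P \<Longrightarrow> r \<odot>\<^bsub>M\<^esub> x \<in> T" for r
    using that unfolding K_def by blast
  have KR: "r \<in> carrier R" and KT: "x \<in> P \<Longrightarrow> r \<odot>\<^bsub>M\<^esub> x \<in> T" if "r \<in> K" for r x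
    using that unfolding K_def by blast+
  have PM': "x \<in> carrier M" if "x \<in> P" for x using that PM by blast
  have "ideal K R"
  proof (rule idealI)
    show "ring R" by (rule R.ring_axioms)
    show "subgroup K (add_monoid R)"
    proof (rule R.add.subgroupI)
      show "K \<subseteq> carrier R" using KR by blast
      have "\<zero> \<in> K" using PM' T.one_closed by (intro KI) simp_all
      then show "K \<noteq> {}" by blast
      show "\<ominus> a \<in> K" if "a \<in> K" for a
        using KR[OF that] KT[OF that] PM' submoduleE(3)[OF T]
        by (intro KI) (simp_all add: smult_l_minus)
      show "a \<oplus> b \<in> K" if "a \<in> K" "b \<in> K" for a b
        using that[THEN KR] that[THEN KT] PM' submoduleE(5)[OF T]
        by (intro KI) (simp_all add: smult_l_distr)
    qed
    show *: "x \<otimes> a \<in> K" if "a \<in> K" "x \<in> carrier R" for a x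
      using KR[OF that(1)] KT[OF that(1)] that(2) PM' submoduleE(4)[OF T]
      by (intro KI) (simp_all add: smult_assoc1)
    show "a \<otimes> x \<in> K" if "a \<in> K" "x \<in> carrier R" for a x
      using *[OF that] that(2) KR[OF that(1)] R.m_comm[of a x] by simp
  qed
  moreover have "G \<subseteq> K" using G(2) pure KI by blast
  ultimately have "Idl\<^bsub>R\<^esub> G \<subseteq> K" by (rule R.genideal_minimal)
  then have "smult_span M (Idl\<^bsub>R\<^esub> G) P \<subseteq> T"
    using KT by (intro smult_span_minimal submodule.axioms(1)[OF T]) blast
  then show ?thesis using z TE by blast
qed

text \<open>For powers of an ideal \<open>I\<close>, this regroups \<open>I\<^bsup>k+1+i\<^esup> N\<close> as \<open>I\<^bsup>k+1\<^esup> (I\<^sup>i N)\<close>, so that the coefficients in front of generators of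
\<open>I\<^bsup>k+1\<^esup>\<close> can be taken in \<open>I\<^sup>i N\<close>.\<close>

lemma smult_span_ideal_prod:
  assumes J: "ideal J R" and K: "ideal K R"
  shows "smult_span M (J \<cdot>\<^bsub>R\<^esub> K) (carrier M) \<subseteq> smult_span M J (smult_span M K (carrier M))"
proof -
  note JR = additive_subgroup.a_subset[OF ideal.axioms(1)[OF J]]
  note KR = additive_subgroup.a_subset[OF ideal.axioms(1)[OF K]]
  note PM = smult_span_subset_carrier[OF KR order_refl]
  let ?S = "smult_span M J (smult_span M K (carrier M))"
  note S = smult_span_subgroup[OF JR PM]
  have "r \<odot>\<^bsub>M\<^esub> x \<in> ?S" if "r \<in> J \<cdot>\<^bsub>R\<^esub> K" and x: "x \<in> carrier M" for r x
    using that(1)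
  proof (induction r rule: ideal_prod.induct)
    case (prod i j)
    then have "(i \<otimes> j) \<odot>\<^bsub>M\<^esub> x = i \<odot>\<^bsub>M\<^esub> (j \<odot>\<^bsub>M\<^esub> x)"
      using JR KR x by (intro smult_assoc1) auto
    then show ?case using prod x by (simp add: smult_span_gen)
  next
    case (sum s1 s2)
    have "s1 \<in> carrier R" "s2 \<in> carrier R"
      using sum R.ideal_prod_in_carrier[OF J K] by auto
    then show ?case using sum x subgroup.m_closed[OF S] by (simp add: smult_l_distr)
  qed
  then show ?thesis by (intro smult_span_minimal[OF S])
qed

lemma finsum_mem_smult_span:
  assumes "finite G" and "G \<subseteq> J" and "J \<subseteq> carrier R" and "P \<subseteq> carrier M" and "\<And>g. g \<in> G \<Longrightarrow> y g \<in> P"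
  shows "(\<Oplus>\<^bsub>M\<^esub>g\<in>G. g \<odot>\<^bsub>M\<^esub> y g) \<in> smult_span M J P"
  using assms(1,2,5)
proof (induction G rule: finite_induct)
  case empty
  show ?case using subgroup.one_closed[OF smult_span_subgroup[OF assms(3,4)]] by simp
next
  case (insert g G)
  have c: "h \<odot>\<^bsub>M\<^esub> y h \<in> carrier M" if "h \<in> insert g G" for h
    using insert.prems that assms(3,4) by blast
  have "g \<odot>\<^bsub>M\<^esub> y g \<in> smult_span M J P" using insert.prems by (intro smult_span_gen) auto
  moreover have "(\<Oplus>\<^bsub>M\<^esub>g\<in>G. g \<odot>\<^bsub>M\<^esub> y g) \<in> smult_span M J P"
    using insert by auto
  ultimately show ?case
    using subgroup.m_closed[OF smult_span_subgroup[OF assms(3,4)]] insert.hyps c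
    by (subst M.finsum_insert) auto
qed

lemma minus_finsum_add:
  assumes "finite G" and "G \<subseteq> carrier R" and "x \<in> carrier M"
    and "w \<in> G \<rightarrow> carrier M" and "v \<in> G \<rightarrow> carrier M"
  shows "x \<ominus>\<^bsub>M\<^esub> (\<Oplus>\<^bsub>M\<^esub>g\<in>G. g \<odot>\<^bsub>M\<^esub> (w g \<oplus>\<^bsub>M\<^esub> v g)) =
    (x \<ominus>\<^bsub>M\<^esub> (\<Oplus>\<^bsub>M\<^esub>g\<in>G. g \<odot>\<^bsub>M\<^esub> w g)) \<ominus>\<^bsub>M\<^esub> (\<Oplus>\<^bsub>M\<^esub>g\<in>G. g \<odot>\<^bsub>M\<^esub> v g)"
proof -
  have *: "g \<in> carrier R" "w g \<in> carrier M" "v g \<in> carrier M" if "g \<in> G" for g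
    using that assms by auto
  have s: "(\<Oplus>\<^bsub>M\<^esub>g\<in>G. g \<odot>\<^bsub>M\<^esub> w g) \<in> carrier M" "(\<Oplus>\<^bsub>M\<^esub>g\<in>G. g \<odot>\<^bsub>M\<^esub> v g) \<in> carrier M"
    using * by (auto intro!: M.finsum_closed)
  have "(\<Oplus>\<^bsub>M\<^esub>g\<in>G. g \<odot>\<^bsub>M\<^esub> (w g \<oplus>\<^bsub>M\<^esub> v g)) = (\<Oplus>\<^bsub>M\<^esub>g\<in>G. g \<odot>\<^bsub>M\<^esub> w g \<oplus>\<^bsub>M\<^esub> g \<odot>\<^bsub>M\<^esub> v g)"
    by (rule M.add.finprod_cong') (use * in \<open>auto simp: smult_r_distr\<close>)
  also have "\<dots> = (\<Oplus>\<^bsub>M\<^esub>g\<in>G. g \<odot>\<^bsub>M\<^esub> w g) \<oplus>\<^bsub>M\<^esub> (\<Oplus>\<^bsub>M\<^esub>g\<in>G. g \<odot>\<^bsub>M\<^esub> v g)"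
    by (rule M.finsum_addf) (use * in auto)
  finally show ?thesis using s assms(3) by (simp add: a_minus_def M.minus_add M.a_assoc)
qed

end

lemma smult_span_image:
  assumes M: "module R M" and N: "module R N" and f: "f \<in> module_hom R M N"
    and J: "J \<subseteq> carrier R" and P: "P \<subseteq> carrier M"
  shows "f ` smult_span M J P = smult_span N J (f ` P)"
proof -
  interpret M: module R M by fact
  interpret N: module R N by fact
  interpret f: group_hom "add_monoid M" "add_monoid N" f
    using f M.a_group N.a_group by (simp add: module_hom_def group_hom_def group_hom_axioms_def)
  have lin: "f (r \<odot>\<^bsub>M\<^esub> x) = r \<odot>\<^bsub>N\<^esub> f x" if "r \<in> J" "x \<in> P" for r x
    using that f J P by (auto simp: module_hom_def)
  have "f ` {r \<odot>\<^bsub>M\<^esub> x | r x. r \<in> J \<and> x \<in> P} = {r \<odot>\<^bsub>N\<^esub> x | r x. r \<in> J \<and> x \<in> f ` P}"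
    using lin by (force simp: image_iff)
  moreover have "{r \<odot>\<^bsub>M\<^esub> x | r x. r \<in> J \<and> x \<in> P} \<subseteq> carrier (add_monoid M)"
    using J P by auto
  ultimately show ?thesis
    unfolding smult_span_def using f.generate_img by (metis (no_types, lifting))
qed

section \<open>Powers of a finitely generated ideal\<close>

context cring
begin

lemma ideal_pow_ideal: "ideal I R \<Longrightarrow> ideal (I [^]\<^bsub>ideals_set R\<^esub> (n::nat)) R"
  using monoid.nat_pow_closed[OF comm_monoid.axioms(1)[OF ideals_set_is_comm_monoid], of I n]
  by (simp add: ideals_set_def)

lemma ideal_pow_add:
  assumes "ideal I R"
  shows "I [^]\<^bsub>ideals_set R\<^esub> (m + n :: nat) = (I [^]\<^bsub>ideals_set R\<^esub> m) \<cdot>\<^bsub>R\<^esub> (I [^]\<^bsub>ideals_set R\<^esub> n)"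
  using monoid.nat_pow_mult[OF comm_monoid.axioms(1)[OF ideals_set_is_comm_monoid], of I m n] assms
  by (simp add: ideals_set_def)

lemma ideal_pow_antimono:
  assumes "ideal I R" and "m \<le> n"
  shows "I [^]\<^bsub>ideals_set R\<^esub> (n :: nat) \<subseteq> I [^]\<^bsub>ideals_set R\<^esub> m"
proof -
  obtain d where "n = m + d" using assms(2) le_Suc_ex by blast
  then show ?thesis
    using ideal_pow_add[OF assms(1), of m d] ideal_prod_inter[OF ideal_pow_ideal ideal_pow_ideal] assms(1)
    by blast
qed

lemma adic_power_ideal: "ideal I R \<Longrightarrow> ideal (adic_power R I k) R"
  unfolding adic_power_def by (rule ideal_pow_ideal)

lemma ideal_colon:
  assumes "ideal X R" and "T \<subseteq> carrier R"
  shows "ideal {r \<in> carrier R. \<forall>t\<in>T. r \<otimes> t \<in> X} R"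
proof -
  interpret X: ideal X R by fact
  have T: "t \<in> carrier R" if "t \<in> T" for t using that assms(2) by blast
  show ?thesis
  proof (rule idealI)
    show "subgroup {r \<in> carrier R. \<forall>t\<in>T. r \<otimes> t \<in> X} (add_monoid R)"
    proof (rule add.subgroupI)
      show "{r \<in> carrier R. \<forall>t\<in>T. r \<otimes> t \<in> X} \<noteq> {}"
        using T by (auto intro!: exI[of _ \<zero>])
    qed (use T in \<open>auto simp: l_distr l_minus a_inv_def[symmetric]\<close>)
    show *: "x \<otimes> a \<in> {r \<in> carrier R. \<forall>t\<in>T. r \<otimes> t \<in> X}"
      if "a \<in> {r \<in> carrier R. \<forall>t\<in>T. r \<otimes> t \<in> X}" "x \<in> carrier R" for a x
      using that T by (auto simp: m_assoc X.I_l_closed)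
    show "a \<otimes> x \<in> {r \<in> carrier R. \<forall>t\<in>T. r \<otimes> t \<in> X}"
      if "a \<in> {r \<in> carrier R. \<forall>t\<in>T. r \<otimes> t \<in> X}" "x \<in> carrier R" for a x
      using *[OF that] that by (simp add: m_comm)
  qed (rule ring_axioms)
qed

text \<open>For the harder inclusion, two colon ideals are used in turn: the elements multiplying \<open>T\<close> into the
right-hand side form an ideal containing \<open>S\<close>, and therefore the elements multiplying \<open>Idl S\<close> into it
form an ideal containing \<open>T\<close>.\<close>

lemma ideal_prod_genideal:
  assumes S: "S \<subseteq> carrier R" and T: "T \<subseteq> carrier R"
  shows "(Idl S) \<cdot>\<^bsub>R\<^esub> (Idl T) = Idl ((\<lambda>(s, t). s \<otimes> t) ` (S \<times> T))"
proof
  let ?X = "(\<lambda>(s, t). s \<otimes> t) ` (S \<times> T)"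
  note IS = genideal_ideal[OF S] and IT = genideal_ideal[OF T]
  have X: "?X \<subseteq> carrier R" using S T by auto
  note IX = genideal_ideal[OF X]
  interpret IX: ideal "Idl ?X" R by (rule IX)
  show "Idl ?X \<subseteq> (Idl S) \<cdot>\<^bsub>R\<^esub> (Idl T)"
    using genideal_self[OF S] genideal_self[OF T]
    by (intro genideal_minimal ideal_prod_is_ideal IS IT) (auto intro!: ideal_prod.prod)
  have "Idl S \<subseteq> {r \<in> carrier R. \<forall>t\<in>T. r \<otimes> t \<in> Idl ?X}"
    using genideal_self[OF X] S by (intro genideal_minimal ideal_colon[OF IX T]) auto
  then have "t \<otimes> s \<in> Idl ?X" if "t \<in> T" "s \<in> Idl S" for s t
    using that m_comm[of t s] T ideal.Icarr[OF IS, of s] by (auto simp: subset_iff)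
  then have "T \<subseteq> {r \<in> carrier R. \<forall>s\<in>Idl S. r \<otimes> s \<in> Idl ?X}"
    using T by blast
  then have "Idl T \<subseteq> {r \<in> carrier R. \<forall>s\<in>Idl S. r \<otimes> s \<in> Idl ?X}"
    by (rule genideal_minimal[OF ideal_colon[OF IX], rotated]) (use ideal.Icarr[OF IS] in blast)
  then have *: "s \<otimes> t \<in> Idl ?X" if "s \<in> Idl S" "t \<in> Idl T" for s t
    using that ideal.Icarr[OF IS, of s] by (auto simp: m_comm[of s] subset_iff)
  show "(Idl S) \<cdot>\<^bsub>R\<^esub> (Idl T) \<subseteq> Idl ?X"
  proof
    fix r assume "r \<in> (Idl S) \<cdot>\<^bsub>R\<^esub> (Idl T)"
    then show "r \<in> Idl ?X" by (induction r rule: ideal_prod.induct) (auto simp: *)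
  qed
qed

lemma ideal_pow_finitely_generated:
  assumes S: "finite S" "S \<subseteq> carrier R"
  shows "\<exists>G. finite G \<and> G \<subseteq> carrier R \<and> (Idl S) [^]\<^bsub>ideals_set R\<^esub> (n::nat) = Idl G"
proof (induction n)
  case 0
  show ?case
    by (rule exI[of _ "{\<one>}"]) (simp add: genideal_one ideals_set_def)
next
  case (Suc n)
  then obtain G where G: "finite G" "G \<subseteq> carrier R" "(Idl S) [^]\<^bsub>ideals_set R\<^esub> n = Idl G" by blast
  have "(Idl S) [^]\<^bsub>ideals_set R\<^esub> Suc n = (Idl G) \<cdot>\<^bsub>R\<^esub> (Idl S)"
    using G(3) by (simp add: ideals_set_def)
  then show ?case
    using ideal_prod_genideal[OF G(2) S(2)] G S
    by (intro exI[of _ "(\<lambda>(s, t). s \<otimes> t) ` (G \<times> S)"]) auto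
qed

end

section \<open>The limit of a tower with adic kernels\<close>

text \<open>The inverse limit. The fields \<open>mult\<close> and \<open>one\<close> of the record have no meaning for a module.\<close>

definition limit_module ::
    "(nat \<Rightarrow> ('r, 'm) module) \<Rightarrow> (nat \<Rightarrow> 'm \<Rightarrow> 'm) \<Rightarrow> ('r, nat \<Rightarrow> 'm) module"
  where "limit_module L \<tau> =
    \<lparr>carrier = {x. \<forall>k. x k \<in> carrier (L k) \<and> \<tau> k (x (Suc k)) = x k},
     monoid.mult = undefined, one = undefined,
     ring.zero = (\<lambda>k. \<zero>\<^bsub>L k\<^esub>), add = (\<lambda>x y k. x k \<oplus>\<^bsub>L k\<^esub> y k),
     smult = (\<lambda>r x k. r \<odot>\<^bsub>L k\<^esub> x k)\<rparr>"

lemma mem_limit_module: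
    "x \<in> carrier (limit_module L \<tau>) \<longleftrightarrow> (\<forall>k. x k \<in> carrier (L k) \<and> \<tau> k (x (Suc k)) = x k)"
  and zero_limit_module [simp]: "\<zero>\<^bsub>limit_module L \<tau>\<^esub> k = \<zero>\<^bsub>L k\<^esub>"
  and add_limit_module [simp]: "(x \<oplus>\<^bsub>limit_module L \<tau>\<^esub> y) k = x k \<oplus>\<^bsub>L k\<^esub> y k"
  and smult_limit_module [simp]: "(r \<odot>\<^bsub>limit_module L \<tau>\<^esub> x) k = r \<odot>\<^bsub>L k\<^esub> x k"
  by (simp_all add: limit_module_def)

text \<open>What remains of an adic system when its levels are regarded as modules over \<open>R\<close> and the bijectivity
of the maps out of the tensor products is spelled out as surjectivity and a description of the kernel.\<close>

locale adic_tower = cring R for R :: "('a, 'x) ring_scheme" (structure) +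
  fixes I :: "'a set" and L :: "nat \<Rightarrow> ('a, 'm) module" and \<tau> :: "nat \<Rightarrow> 'm \<Rightarrow> 'm"
  assumes ideal_I: "ideal I R"
    and module_L: "module R (L k)"
    and trans_hom: "\<tau> k \<in> module_hom R (L (Suc k)) (L k)"
    and trans_surj: "\<tau> k ` carrier (L (Suc k)) = carrier (L k)"
    and trans_kernel: "\<lbrakk>x \<in> carrier (L (Suc k)); \<tau> k x = \<zero>\<^bsub>L k\<^esub>\<rbrakk> \<Longrightarrow>
      x \<in> smult_span (L (Suc k)) (adic_power R I k) (carrier (L (Suc k)))"
    and level_annihilated: "\<lbrakk>r \<in> adic_power R I k; x \<in> carrier (L k)\<rbrakk> \<Longrightarrow> r \<odot>\<^bsub>L k\<^esub> x = \<zero>\<^bsub>L k\<^esub>"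
begin

abbreviation "N \<equiv> limit_module L \<tau>"

sublocale L: module R "L k" for k by (rule module_L)

lemma trans_closed: "x \<in> carrier (L (Suc k)) \<Longrightarrow> \<tau> k x \<in> carrier (L k)"
  and trans_add: "\<lbrakk>x \<in> carrier (L (Suc k)); y \<in> carrier (L (Suc k))\<rbrakk> \<Longrightarrow>
    \<tau> k (x \<oplus>\<^bsub>L (Suc k)\<^esub> y) = \<tau> k x \<oplus>\<^bsub>L k\<^esub> \<tau> k y"
  and trans_smult: "\<lbrakk>r \<in> carrier R; x \<in> carrier (L (Suc k))\<rbrakk> \<Longrightarrow>
    \<tau> k (r \<odot>\<^bsub>L (Suc k)\<^esub> x) = r \<odot>\<^bsub>L k\<^esub> \<tau> k x"
  using trans_hom[of k] by (auto simp: module_hom_def hom_def Pi_iff)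

lemma trans_zero: "\<tau> k \<zero>\<^bsub>L (Suc k)\<^esub> = \<zero>\<^bsub>L k\<^esub>"
  using trans_smult[of \<zero> "\<zero>\<^bsub>L (Suc k)\<^esub>" k] trans_closed by simp

lemma limit_component: "x \<in> carrier N \<Longrightarrow> x k \<in> carrier (L k)"
  and limit_compatible: "x \<in> carrier N \<Longrightarrow> \<tau> k (x (Suc k)) = x k"
  by (simp_all add: mem_limit_module)

lemma module_limit: "module R N"
proof (rule moduleI)
  show "cring R" by (rule is_cring)
  show "abelian_group N"
  proof (rule abelian_groupI)
    show "\<exists>y\<in>carrier N. y \<oplus>\<^bsub>N\<^esub> x = \<zero>\<^bsub>N\<^esub>" if x: "x \<in> carrier N" for x
    proof
      note c = limit_component[OF x]
      have neg: "\<ominus> \<one> \<odot>\<^bsub>L k\<^esub> y = \<ominus>\<^bsub>L k\<^esub> y" if "y \<in> carrier (L k)" for k y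
        using that by (simp add: L.smult_l_minus)
      show "(\<lambda>k. \<ominus> \<one> \<odot>\<^bsub>L k\<^esub> x k) \<in> carrier N"
        using c by (simp add: mem_limit_module trans_smult limit_compatible[OF x])
      show "(\<lambda>k. \<ominus> \<one> \<odot>\<^bsub>L k\<^esub> x k) \<oplus>\<^bsub>N\<^esub> x = \<zero>\<^bsub>N\<^esub>"
        using c by (auto simp: fun_eq_iff neg L.M.l_neg)
    qed
  qed (auto simp: mem_limit_module fun_eq_iff L.M.a_ac trans_add trans_zero)
qed (auto simp: mem_limit_module fun_eq_iff L.smult_l_distr L.smult_r_distr L.smult_assoc1
    trans_smult)

sublocale N: module R N by (rule module_limit)

lemma component_hom: "(\<lambda>x. x k) \<in> module_hom R N (L k)"
  by (auto simp: module_hom_def hom_def mem_limit_module)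

lemma minus_component: "\<lbrakk>x \<in> carrier N; y \<in> carrier N\<rbrakk> \<Longrightarrow> (x \<ominus>\<^bsub>N\<^esub> y) k = x k \<ominus>\<^bsub>L k\<^esub> y k"
proof -
  assume x: "x \<in> carrier N" and y: "y \<in> carrier N"
  have "\<ominus>\<^bsub>N\<^esub> y = (\<ominus> \<one>) \<odot>\<^bsub>N\<^esub> y" using y by (simp add: N.smult_l_minus)
  then have "(\<ominus>\<^bsub>N\<^esub> y) k = \<ominus>\<^bsub>L k\<^esub> (y k)"
    using limit_component[OF y, of k] by (simp add: L.smult_l_minus)
  then show ?thesis by (simp add: a_minus_def)
qed

lemma finsum_component:
  assumes "finite G" and "f \<in> G \<rightarrow> carrier N"
  shows "(\<Oplus>\<^bsub>N\<^esub>g\<in>G. f g) k = (\<Oplus>\<^bsub>L k\<^esub>g\<in>G. f g k)"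
  using assms
proof (induction G rule: finite_induct)
  case (insert g G)
  then have "f g \<in> carrier N" "f \<in> G \<rightarrow> carrier N" by auto
  then show ?case
    using insert limit_component
    by (subst N.finsum_insert, simp_all add: Pi_iff)
qed simp

text \<open>A given \<open>m\<close> at level \<open>k\<close> determines the components below \<open>k\<close>, and the components above are chosen one
after the other by surjectivity of the transitions.\<close>

lemma component_surj:
  assumes "m \<in> carrier (L k)"
  shows "\<exists>x\<in>carrier N. x k = m"
proof -
  \<comment> \<open>The components up to level \<open>k\<close> are the images of \<open>m\<close> under iterated transitions.\<close>
  have "\<exists>p. (\<forall>n\<le>k. p n \<in> carrier (L n)) \<and> (\<forall>n<k. \<tau> n (p (Suc n)) = p n) \<and> p k = m"
    using assms
  proof (induction k arbitrary: m)
    case 0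
    then show ?case by (intro exI[of _ "\<lambda>_. m"]) simp
  next
    case (Suc k)
    from Suc.IH[OF trans_closed[OF Suc.prems]]
    obtain p where "\<forall>n\<le>k. p n \<in> carrier (L n)" "\<forall>n<k. \<tau> n (p (Suc n)) = p n" "p k = \<tau> k m"
      by blast
    then show ?case
      using Suc.prems by (intro exI[of _ "p(Suc k := m)"]) (auto simp: less_Suc_eq le_Suc_eq)
  qed
  then obtain p where p: "\<And>n. n \<le> k \<Longrightarrow> p n \<in> carrier (L n)"
    "\<And>n. n < k \<Longrightarrow> \<tau> n (p (Suc n)) = p n" "p k = m" by blast
  have "\<exists>x. \<forall>n. (x n \<in> carrier (L n) \<and> (n \<le> k \<longrightarrow> x n = p n)) \<and> \<tau> n (x (Suc n)) = x n"
  proof (rule dependent_nat_choice)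
    show "\<exists>y. y \<in> carrier (L 0) \<and> (0 \<le> k \<longrightarrow> y = p 0)" using p(1) by blast
    fix x n assume x: "x \<in> carrier (L n) \<and> (n \<le> k \<longrightarrow> x = p n)"
    show "\<exists>y. (y \<in> carrier (L (Suc n)) \<and> (Suc n \<le> k \<longrightarrow> y = p (Suc n))) \<and> \<tau> n y = x"
    proof (cases "Suc n \<le> k")
      case True
      then show ?thesis using p(1)[of "Suc n"] p(2)[of n] x by auto
    next
      case False
      then show ?thesis using x trans_surj[of n] by (metis imageE)
    qed
  qed
  then show ?thesis using p(3) by (auto simp: mem_limit_module)
qed

text \<open>The easy half of the computation of the kernel of \<open>N \<rightarrow> L\<^sub>k\<close>: it contains \<open>I\<^bsup>k+1\<^esup> N\<close>. The version for
a smaller set \<open>J\<close> serves to see that elements of \<open>I\<^sup>i N\<close> with \<open>i > k\<close> vanish at level \<open>k\<close>.\<close>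

lemma component_span_zero:
  assumes J: "J \<subseteq> adic_power R I k" and x: "x \<in> smult_span N J (carrier N)"
  shows "x k = \<zero>\<^bsub>L k\<^esub>"
proof -
  have *: "{x \<in> carrier N. x k = \<zero>\<^bsub>L k\<^esub>} = kernel (add_monoid N) (add_monoid (L k)) (\<lambda>x. x k)"
    by (simp add: kernel_def)
  have "group_hom (add_monoid N) (add_monoid (L k)) (\<lambda>x. x k)"
    using component_hom[of k] N.M.a_group L.M.a_group[of k]
    by (simp add: group_hom_def group_hom_axioms_def module_hom_def)
  then have "subgroup {x \<in> carrier N. x k = \<zero>\<^bsub>L k\<^esub>} (add_monoid N)"
    unfolding * by (rule group_hom.subgroup_kernel)
  moreover have "r \<odot>\<^bsub>N\<^esub> y \<in> {x \<in> carrier N. x k = \<zero>\<^bsub>L k\<^esub>}"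
    if "r \<in> J" "y \<in> carrier N" for r y
  proof -
    have "r \<in> carrier R" using that J ideal.Icarr[OF adic_power_ideal[OF ideal_I]] by blast
    then show ?thesis using that J level_annihilated[of r k "y k"] limit_component[of y k] by auto
  qed
  ultimately show ?thesis using N.smult_span_minimal x by blast
qed

lemma component_zero_downwards:
  assumes x: "x \<in> carrier N" and "n \<le> m" and "x m = \<zero>\<^bsub>L m\<^esub>"
  shows "x n = \<zero>\<^bsub>L n\<^esub>"
  using assms(2,3)
proof (induction rule: inc_induct)
  case (step n)
  then show ?case using limit_compatible[OF x, of n] trans_zero[of n] by simp
qed

text \<open>One more level of accuracy: the component of \<open>z\<close> at level \<open>k+i+1\<close> lies in the kernel of a transition,
which is \<open>I\<^bsup>k+1+i\<^esup> L\<^bsub>k+i+1\<^esub>\<close>. Since \<open>N\<close> maps onto that level, the component lifts to an element of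
\<open>I\<^bsup>k+1+i\<^esup> N = I\<^bsup>k+1\<^esup> (I\<^sup>i N)\<close>, which is a combination of the generators \<open>G\<close> with coefficients in \<open>I\<^sup>i N\<close>.\<close>

lemma approximation_step:
  assumes G: "finite G" "G \<subseteq> carrier R" "adic_power R I k = Idl G"
    and z: "z \<in> carrier N" "z (k + i) = \<zero>\<^bsub>L (k + i)\<^esub>"
  shows "\<exists>v. (\<forall>g\<in>G. v g \<in> smult_span N (I [^]\<^bsub>ideals_set R\<^esub> i) (carrier N)) \<and>
    (z \<ominus>\<^bsub>N\<^esub> (\<Oplus>\<^bsub>N\<^esub>g\<in>G. g \<odot>\<^bsub>N\<^esub> v g)) (Suc (k + i)) = \<zero>\<^bsub>L (Suc (k + i))\<^esub>"
proof -
  let ?m = "Suc (k + i)"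
  let ?P = "smult_span N (I [^]\<^bsub>ideals_set R\<^esub> i) (carrier N)"
  have sub: "J \<subseteq> carrier R" if "ideal J R" for J using ideal.Icarr[OF that] by blast
  have idp: "ideal (I [^]\<^bsub>ideals_set R\<^esub> (n::nat)) R" for n
    by (rule ideal_pow_ideal[OF ideal_I])
  have P: "submodule ?P R N"
    by (rule N.smult_span_submodule[OF sub[OF idp] N.carrier_is_submodule])
  have surj: "(\<lambda>x. x ?m) ` carrier N = carrier (L ?m)"
    using component_surj limit_component by (force simp: image_iff)
  have "z ?m \<in> smult_span (L ?m) (adic_power R I (k + i)) (carrier (L ?m))"
    using trans_kernel[of "z ?m" "k + i"] limit_component[OF z(1)] limit_compatible[OF z(1), of "k + i"] z(2)
    by simp
  also have "\<dots> = (\<lambda>x. x ?m) ` smult_span N (adic_power R I (k + i)) (carrier N)"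
    using smult_span_image[OF module_limit module_L component_hom[of ?m]
        sub[OF adic_power_ideal[OF ideal_I, of "k + i"]] order_refl] surj
    by simp
  also have "adic_power R I (k + i) = (Idl G) \<cdot>\<^bsub>R\<^esub> (I [^]\<^bsub>ideals_set R\<^esub> i)"
    using ideal_pow_add[OF ideal_I, of "Suc k" i] G(3) by (simp add: adic_power_def)
  finally obtain z' where z': "z' \<in> smult_span N ((Idl G) \<cdot>\<^bsub>R\<^esub> (I [^]\<^bsub>ideals_set R\<^esub> i)) (carrier N)" "z ?m = z' ?m"
    by blast
  have "z' \<in> smult_span N (Idl G) ?P"
    using N.smult_span_ideal_prod[OF genideal_ideal[OF G(2)] idp] z'(1) by blast
  from N.smult_span_finite_generators[OF G(1,2) P this]
  obtain v where v: "\<forall>g\<in>G. v g \<in> ?P" "z' = (\<Oplus>\<^bsub>N\<^esub>g\<in>G. g \<odot>\<^bsub>N\<^esub> v g)" by blast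
  have "z' \<in> carrier N"
    using z'(1) N.smult_span_subset_carrier[OF sub[OF ideal_prod_is_ideal[OF genideal_ideal[OF G(2)] idp]] order_refl]
    by blast
  then have "(z \<ominus>\<^bsub>N\<^esub> z') ?m = \<zero>\<^bsub>L ?m\<^esub>"
    using minus_component[OF z(1), of z' ?m] z'(2) limit_component[of z' ?m]
    by (simp add: a_minus_def L.M.r_neg)
  then show ?thesis using v by blast
qed

text \<open>The hard half: successive approximation by combinations \<open>\<Sum>\<^bsub>g\<in>G\<^esub> g w\<^sub>n(g)\<close> over a fixed finite set \<open>G\<close> of
generators of \<open>I\<^bsup>k+1\<^esup>\<close>. The coefficients \<open>w\<^sub>n(g)\<close> change by elements of \<open>I\<^sup>n N\<close> only, so each of
their components becomes stationary and they converge in the limit module.\<close>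

lemma component_kernel:
  assumes fg: "\<exists>S. finite S \<and> S \<subseteq> carrier R \<and> I = Idl S"
    and x: "x \<in> carrier N" "x k = \<zero>\<^bsub>L k\<^esub>"
  shows "x \<in> smult_span N (adic_power R I k) (carrier N)"
proof -
  obtain S where "finite S" "S \<subseteq> carrier R" "I = Idl S" using fg by blast
  then obtain G where G: "finite G" "G \<subseteq> carrier R" "adic_power R I k = Idl G"
    using ideal_pow_finitely_generated[of S "Suc k"] by (auto simp: adic_power_def simp del: nat_pow_Suc)
  let ?P = "\<lambda>i. smult_span N (I [^]\<^bsub>ideals_set R\<^esub> (i::nat)) (carrier N)"
  let ?s = "\<lambda>y. \<Oplus>\<^bsub>N\<^esub>g\<in>G. g \<odot>\<^bsub>N\<^esub> y g"
  have PN: "?P i \<subseteq> carrier N" for i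
    using ideal.Icarr[OF ideal_pow_ideal[OF ideal_I]] by (intro N.smult_span_subset_carrier) auto
  have s_closed: "?s y \<in> carrier N" if "y \<in> G \<rightarrow> carrier N" for y
    using that G(2) by (auto intro!: N.finsum_closed)
  have "\<exists>w. \<forall>n. ((w n \<in> G \<rightarrow> carrier N) \<and> (x \<ominus>\<^bsub>N\<^esub> ?s (w n)) (k + n) = \<zero>\<^bsub>L (k + n)\<^esub>) \<and>
    (\<forall>g\<in>G. \<exists>v\<in>?P n. w (Suc n) g = w n g \<oplus>\<^bsub>N\<^esub> v)"
  proof (rule dependent_nat_choice)
    have "?s (\<lambda>_. \<zero>\<^bsub>N\<^esub>) = \<zero>\<^bsub>N\<^esub>"
      using G by (subst N.add.finprod_cong'[of _ _ "\<lambda>_. \<zero>\<^bsub>N\<^esub>"]) auto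
    then have "(x \<ominus>\<^bsub>N\<^esub> ?s (\<lambda>_. \<zero>\<^bsub>N\<^esub>)) (k + 0) = \<zero>\<^bsub>L (k + 0)\<^esub>"
      using x N.M.minus_zero_right[OF x(1)] by simp
    then show "\<exists>w. w \<in> G \<rightarrow> carrier N \<and> (x \<ominus>\<^bsub>N\<^esub> ?s w) (k + 0) = \<zero>\<^bsub>L (k + 0)\<^esub>"
      by (intro exI[of _ "\<lambda>_. \<zero>\<^bsub>N\<^esub>"]) simp
  next
    fix w n assume w: "w \<in> G \<rightarrow> carrier N \<and> (x \<ominus>\<^bsub>N\<^esub> ?s w) (k + n) = \<zero>\<^bsub>L (k + n)\<^esub>"
    have "x \<ominus>\<^bsub>N\<^esub> ?s w \<in> carrier N" using x(1) s_closed[OF conjunct1[OF w]] by simp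
    from approximation_step[OF G this conjunct2[OF w]] obtain v where v: "\<forall>g\<in>G. v g \<in> ?P n"
      "(x \<ominus>\<^bsub>N\<^esub> ?s w \<ominus>\<^bsub>N\<^esub> ?s v) (Suc (k + n)) = \<zero>\<^bsub>L (Suc (k + n))\<^esub>"
      by blast
    have "v \<in> G \<rightarrow> carrier N" using v(1) PN by blast
    then have "(x \<ominus>\<^bsub>N\<^esub> ?s (\<lambda>g. w g \<oplus>\<^bsub>N\<^esub> v g)) (k + Suc n) = \<zero>\<^bsub>L (k + Suc n)\<^esub>"
      using N.minus_finsum_add[OF G(1,2) x(1), of w v] w v(2) by simp
    moreover have "(\<lambda>g. w g \<oplus>\<^bsub>N\<^esub> v g) \<in> G \<rightarrow> carrier N"
      using w \<open>v \<in> G \<rightarrow> carrier N\<close> by auto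
    ultimately show "\<exists>w'. (w' \<in> G \<rightarrow> carrier N \<and> (x \<ominus>\<^bsub>N\<^esub> ?s w') (k + Suc n) = \<zero>\<^bsub>L (k + Suc n)\<^esub>) \<and>
        (\<forall>g\<in>G. \<exists>u\<in>?P n. w' g = w g \<oplus>\<^bsub>N\<^esub> u)"
      using v(1) by (intro exI[of _ "\<lambda>g. w g \<oplus>\<^bsub>N\<^esub> v g"]) blast
  qed
  then obtain w where w: "\<And>n. w n \<in> G \<rightarrow> carrier N"
    and approx: "\<And>n. (x \<ominus>\<^bsub>N\<^esub> ?s (w n)) (k + n) = \<zero>\<^bsub>L (k + n)\<^esub>"
    and next_w: "\<And>n g. g \<in> G \<Longrightarrow> \<exists>v\<in>?P n. w (Suc n) g = w n g \<oplus>\<^bsub>N\<^esub> v"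
    by blast
  have wN: "w n g \<in> carrier N" if "g \<in> G" for n g using w that by auto
  \<comment> \<open>From stage \<open>n + 1\<close> on, the corrections lie in \<open>I\<^sup>i N\<close> with \<open>i > n\<close> and so vanish at level \<open>n\<close>.\<close>
  have stable: "w i g n = w (Suc n) g n" if g: "g \<in> G" and i: "Suc n \<le> i" for g n i
    using i
  proof (induction i rule: dec_induct)
    case (step i)
    obtain v where v: "v \<in> ?P i" "w (Suc i) g = w i g \<oplus>\<^bsub>N\<^esub> v" using next_w[OF g] by blast
    have "v n = \<zero>\<^bsub>L n\<^esub>"
      using component_span_zero[OF _ v(1), of n] ideal_pow_antimono[OF ideal_I, of "Suc n" i] step(1)
      by (simp add: adic_power_def)
    then show ?case using v(2) step(3) limit_component[OF wN[OF g]] by simp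
  qed simp
  \<comment> \<open>The limit of the coefficients, read off at the first stage where level \<open>n\<close> is stationary.\<close>
  define y where "y g n = w (Suc n) g n" for g n
  have y: "y g \<in> carrier N" if g: "g \<in> G" for g
    unfolding mem_limit_module
  proof (intro allI conjI)
    fix n
    show "y g n \<in> carrier (L n)"
      unfolding y_def by (rule limit_component[OF wN[OF g]])
    have "\<tau> n (y g (Suc n)) = w (Suc (Suc n)) g n"
      unfolding y_def by (rule limit_compatible[OF wN[OF g]])
    then show "\<tau> n (y g (Suc n)) = y g n"
      using stable[OF g, of n "Suc (Suc n)"] by (simp add: y_def)
  qed
  have "x = ?s y"
  proof
    fix n
    have sw: "?s (w (Suc n)) \<in> carrier N" using s_closed w by blast
    have "(x \<ominus>\<^bsub>N\<^esub> ?s (w (Suc n))) n = \<zero>\<^bsub>L n\<^esub>"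
      using component_zero_downwards[of "x \<ominus>\<^bsub>N\<^esub> ?s (w (Suc n))" n "k + Suc n"] approx[of "Suc n"] x(1) sw
      by simp
    then have "x n \<ominus>\<^bsub>L n\<^esub> ?s (w (Suc n)) n = \<zero>\<^bsub>L n\<^esub>"
      using minus_component[OF x(1) sw] by simp
    then have "x n = ?s (w (Suc n)) n"
      using L.M.minus_eq_zero_iff[OF limit_component[OF x(1)] limit_component[OF sw]] by blast
    also have "\<dots> = (\<Oplus>\<^bsub>L n\<^esub>g\<in>G. (g \<odot>\<^bsub>N\<^esub> w (Suc n) g) n)"
      by (rule finsum_component[OF G(1)]) (use wN G(2) in auto)
    also have "\<dots> = (\<Oplus>\<^bsub>L n\<^esub>g\<in>G. (g \<odot>\<^bsub>N\<^esub> y g) n)"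
      by (simp add: y_def)
    also have "\<dots> = ?s y n"
      by (rule finsum_component[OF G(1), of "\<lambda>g. g \<odot>\<^bsub>N\<^esub> y g", symmetric]) (use y G(2) in auto)
    finally show "x n = ?s y n" .
  qed
  also have "\<dots> \<in> smult_span N (adic_power R I k) (carrier N)"
    using G genideal_self[OF G(2)] y ideal.Icarr[OF adic_power_ideal[OF ideal_I, of k]]
    by (intro N.finsum_mem_smult_span) auto
  finally show ?thesis .
qed

end

section \<open>Restriction of scalars\<close>

lemma carrier_regular_module [simp]: "carrier (regular_module S) = carrier S"
  and add_regular_module [simp]: "add (regular_module S) = add S"
  and zero_regular_module [simp]: "ring.zero (regular_module S) = ring.zero S"
  and smult_regular_module [simp]: "smult (regular_module S) = monoid.mult S"
  by (simp_all add: regular_module_def)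

lemma carrier_restrict_scalars [simp]: "carrier (restrict_scalars \<phi> M) = carrier M"
  and add_restrict_scalars [simp]: "add (restrict_scalars \<phi> M) = add M"
  and zero_restrict_scalars [simp]: "ring.zero (restrict_scalars \<phi> M) = ring.zero M"
  and smult_restrict_scalars [simp]: "smult (restrict_scalars \<phi> M) r x = \<phi> r \<odot>\<^bsub>M\<^esub> x"
  by (simp_all add: restrict_scalars_def)

lemma (in cring) module_regular_module: "module R (regular_module R)"
proof (rule moduleI)
  show "abelian_group (regular_module R)"
    by (rule abelian_groupI) (auto simp: a_ac intro: add.l_inv_ex)
qed (auto simp: l_distr r_distr m_assoc is_cring)

lemma module_restrict_scalars:
  assumes "cring R" and "\<phi> \<in> ring_hom R S" and "module S M"
  shows "module R (restrict_scalars \<phi> M)"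
proof -
  interpret R: cring R by fact
  interpret M: module S M by fact
  note hom [simp] = ring_hom_closed[OF assms(2)] ring_hom_add[OF assms(2)]
    ring_hom_mult[OF assms(2)] ring_hom_one[OF assms(2)]
  show ?thesis
  proof (rule moduleI)
    show "abelian_group (restrict_scalars \<phi> M)"
      by (rule abelian_groupI) (auto simp: M.a_ac intro: M.add.l_inv_ex)
  qed (auto simp: M.smult_l_distr M.smult_r_distr M.smult_assoc1 assms(1))
qed

section \<open>Computing in tensor products\<close>

lemma tensor_relations_subgroup:
  assumes "module R M" and "module R N"
  shows "subgroup (tensor_relations R M N) (tensor_free M N)"
proof -
  interpret M: module R M by fact
  interpret N: module R N by fact
  have two: "frag_of p - frag_of q \<in> carrier (tensor_free M N)"
    if "p \<in> carrier M \<times> carrier N" "q \<in> carrier M \<times> carrier N" for p q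
    using keys_diff[of "frag_of p" "frag_of q"] that by (auto simp: keys_frag_of)
  have three: "frag_of p - frag_of q - frag_of r \<in> carrier (tensor_free M N)"
    if "p \<in> carrier M \<times> carrier N" "q \<in> carrier M \<times> carrier N" "r \<in> carrier M \<times> carrier N" for p q r
    using keys_diff[of "frag_of p - frag_of q" "frag_of r"] two[OF that(1,2)] that(3)
    by (auto simp: keys_frag_of)
  show ?thesis
    unfolding tensor_relations_def
    by (rule group.generate_is_subgroup[OF group_free_Abelian_group])
      (auto simp del: carrier_free_Abelian_group_iff intro!: two three)
qed

lemma tensor_relations_add_left:
  "x \<in> carrier M \<Longrightarrow> x' \<in> carrier M \<Longrightarrow> y \<in> carrier N \<Longrightarrow>
   frag_of (x \<oplus>\<^bsub>M\<^esub> x', y) - frag_of (x, y) - frag_of (x', y) \<in> tensor_relations R M N"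
  unfolding tensor_relations_def by (intro generate.incl) blast

lemma tensor_relations_add_right:
  "x \<in> carrier M \<Longrightarrow> y \<in> carrier N \<Longrightarrow> y' \<in> carrier N \<Longrightarrow>
   frag_of (x, y \<oplus>\<^bsub>N\<^esub> y') - frag_of (x, y) - frag_of (x, y') \<in> tensor_relations R M N"
  unfolding tensor_relations_def by (intro generate.incl) blast

lemma tensor_relations_smult:
  "r \<in> carrier R \<Longrightarrow> x \<in> carrier M \<Longrightarrow> y \<in> carrier N \<Longrightarrow>
   frag_of (r \<odot>\<^bsub>M\<^esub> x, y) - frag_of (x, r \<odot>\<^bsub>N\<^esub> y) \<in> tensor_relations R M N"
  unfolding tensor_relations_def by (intro generate.incl) blast

text \<open>The universal property of the tensor product, one step before passing to the quotient: a homomorphism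
from the free group respects the relations modulo a subgroup \<open>H\<close> as soon as it does so on the three
families of generators. Keeping \<open>H\<close> general avoids forming quotient groups of the target.\<close>

lemma tensor_relations_hom_image:
  assumes M: "module R M" and N: "module R N" and "group G" and "subgroup H G"
    and h: "h \<in> hom (tensor_free M N) G"
    and "\<And>x x' y. \<lbrakk>x \<in> carrier M; x' \<in> carrier M; y \<in> carrier N\<rbrakk> \<Longrightarrow>
      h (frag_of (x \<oplus>\<^bsub>M\<^esub> x', y) - frag_of (x, y) - frag_of (x', y)) \<in> H"
    and "\<And>x y y'. \<lbrakk>x \<in> carrier M; y \<in> carrier N; y' \<in> carrier N\<rbrakk> \<Longrightarrow>
      h (frag_of (x, y \<oplus>\<^bsub>N\<^esub> y') - frag_of (x, y) - frag_of (x, y')) \<in> H"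
    and "\<And>r x y. \<lbrakk>r \<in> carrier R; x \<in> carrier M; y \<in> carrier N\<rbrakk> \<Longrightarrow>
      h (frag_of (r \<odot>\<^bsub>M\<^esub> x, y) - frag_of (x, r \<odot>\<^bsub>N\<^esub> y)) \<in> H"
    and c: "c \<in> tensor_relations R M N"
  shows "h c \<in> H"
proof -
  interpret h: group_hom "tensor_free M N" G h
    using assms by (simp add: group_hom_def group_hom_axioms_def)
  have sub: "tensor_relations R M N \<subseteq> carrier (tensor_free M N)"
    using tensor_relations_subgroup[OF M N] subgroup.subset by blast
  show ?thesis
    using c subgroup.subset[OF tensor_relations_subgroup[OF M N]] unfolding tensor_relations_def
  proof (induction c rule: generate.induct)
    case one
    show ?case using h.hom_one assms(4) by (simp add: subgroup.one_closed del: one_free_Abelian_group)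
  next
    case (incl g)
    then show ?case using assms(6,7,8) by blast
  next
    case (inv g)
    from inv have "g \<in> carrier (tensor_free M N)"
      using sub unfolding tensor_relations_def by (meson generate.incl subsetD)
    moreover have "h g \<in> H" using inv assms(6,7,8) by blast
    ultimately show ?case using assms(4) by (simp only: h.hom_inv subgroup.m_inv_closed)
  next
    case (eng g1 g2)
    then show ?case
      using sub assms(4) by (simp only: tensor_relations_def[symmetric] subsetD h.hom_mult subgroup.m_closed)
  qed
qed

lemma tensor_coset_eq_iff:
  assumes "module R M" and "module R N"
    and "c \<in> carrier (tensor_free M N)" and "d \<in> carrier (tensor_free M N)"
  shows "tensor_relations R M N #>\<^bsub>tensor_free M N\<^esub> c = tensor_relations R M N #>\<^bsub>tensor_free M N\<^esub> d
    \<longleftrightarrow> c - d \<in> tensor_relations R M N"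
proof -
  let ?F = "tensor_free M N" and ?Q = "tensor_relations R M N"
  interpret F: group ?F by simp
  note Q = tensor_relations_subgroup[OF assms(1,2)]
  have eq: "c \<otimes>\<^bsub>?F\<^esub> inv\<^bsub>?F\<^esub> d = c - d" using assms(3,4) by simp
  have "?Q #>\<^bsub>?F\<^esub> c = ?Q #>\<^bsub>?F\<^esub> d \<longleftrightarrow> c \<in> ?Q #>\<^bsub>?F\<^esub> d"
    using F.repr_independence[OF _ assms(4) Q] F.rcos_self[OF assms(3) Q] by blast
  then show ?thesis
    using subgroup.rcos_module[OF Q F.is_group assms(4,3)] eq by simp
qed

text \<open>Linearity of \<open>f\<close> and \<open>g\<close> makes all members of the union that defines \<^const>\<open>tensor_map\<close> equal, so
that any representative may be used.\<close>

lemma tensor_map_coset: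
  assumes M': "module R M'" and N': "module R N'" and M: "module R M" and N: "module R N"
    and f: "f \<in> module_hom R M' M" and g: "g \<in> module_hom R N' N"
    and c: "c \<in> carrier (tensor_free M' N')"
  shows "tensor_map R M N f g (tensor_relations R M' N' #>\<^bsub>tensor_free M' N'\<^esub> c) =
    tensor_relations R M N #>\<^bsub>tensor_free M N\<^esub> frag_extend (\<lambda>(x, y). frag_of (f x, g y)) c"
proof -
  let ?h = "frag_extend (\<lambda>(x, y). frag_of (f x, g y))"
  interpret F': group "tensor_free M' N'" by simp
  have fm: "f x \<in> carrier M" "f (x \<oplus>\<^bsub>M'\<^esub> x') = f x \<oplus>\<^bsub>M\<^esub> f x'"
    "r \<in> carrier R \<Longrightarrow> f (r \<odot>\<^bsub>M'\<^esub> x) = r \<odot>\<^bsub>M\<^esub> f x"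
    if "x \<in> carrier M'" "x' \<in> carrier M'" for x x' r
    using f that by (auto simp: module_hom_def hom_def Pi_iff)
  have gm: "g x \<in> carrier N" "g (x \<oplus>\<^bsub>N'\<^esub> x') = g x \<oplus>\<^bsub>N\<^esub> g x'"
    "r \<in> carrier R \<Longrightarrow> g (r \<odot>\<^bsub>N'\<^esub> x) = r \<odot>\<^bsub>N\<^esub> g x"
    if "x \<in> carrier N'" "x' \<in> carrier N'" for x x' r
    using g that by (auto simp: module_hom_def hom_def Pi_iff)
  have carr: "?h d \<in> carrier (tensor_free M N)" if "d \<in> carrier (tensor_free M' N')" for d
  proof -
    have "Poly_Mapping.keys (?h d) \<subseteq> (\<Union>p\<in>Poly_Mapping.keys d. {(f (fst p), g (snd p))})"
      using keys_frag_extend[of "\<lambda>(x, y). frag_of (f x, g y)" d]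
      by (simp add: case_prod_beta keys_frag_of)
    moreover have "(f (fst p), g (snd p)) \<in> carrier M \<times> carrier N" if "p \<in> carrier M' \<times> carrier N'" for p
      using that fm(1) gm(1) by auto
    ultimately show ?thesis using that unfolding carrier_free_Abelian_group_iff by blast
  qed
  have hom: "?h \<in> hom (tensor_free M' N') (tensor_free M N)"
    using carr by (auto intro!: homI simp: frag_extend_add simp del: carrier_free_Abelian_group_iff)
  have rel: "?h d \<in> tensor_relations R M N" if "d \<in> tensor_relations R M' N'" for d
    by (rule tensor_relations_hom_image[OF M' N' _ tensor_relations_subgroup[OF M N] hom _ _ _ that])
      (simp_all add: frag_extend_diff fm gm tensor_relations_add_left tensor_relations_add_right
        tensor_relations_smult)
  note Q' = tensor_relations_subgroup[OF M' N']
  have "tensor_relations R M N #>\<^bsub>tensor_free M N\<^esub> ?h d = tensor_relations R M N #>\<^bsub>tensor_free M N\<^esub> ?h c"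
    if d: "d \<in> tensor_relations R M' N' #>\<^bsub>tensor_free M' N'\<^esub> c" for d
  proof -
    have dc: "d \<in> carrier (tensor_free M' N')"
      using subgroup.elemrcos_carrier[OF Q' F'.is_group c d] .
    have "d - c \<in> tensor_relations R M' N'"
      using subgroup.rcos_module_imp[OF Q' F'.is_group c d] c by simp
    then have "?h d - ?h c \<in> tensor_relations R M N"
      using rel by (metis frag_extend_diff)
    then show ?thesis
      using tensor_coset_eq_iff[OF M N carr[OF dc] carr[OF c]] by simp
  qed
  moreover have "c \<in> tensor_relations R M' N' #>\<^bsub>tensor_free M' N'\<^esub> c"
    using F'.rcos_self[OF c Q'] .
  ultimately show ?thesis unfolding tensor_map_def by blast
qed

text \<open>A biadditive balanced map extends to a homomorphism on the free group that vanishes on the relations.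
It is therefore constant on cosets, and \<^const>\<open>tensor_lift\<close> takes the value at any representative.\<close>

lemma tensor_lift_pure:
  assumes M: "module R M" and N: "module R N" and "abelian_group T"
    and b: "\<And>x y. \<lbrakk>x \<in> carrier M; y \<in> carrier N\<rbrakk> \<Longrightarrow> \<beta> (x, y) \<in> carrier T"
    and b1: "\<And>x x' y. \<lbrakk>x \<in> carrier M; x' \<in> carrier M; y \<in> carrier N\<rbrakk> \<Longrightarrow>
      \<beta> (x \<oplus>\<^bsub>M\<^esub> x', y) = \<beta> (x, y) \<oplus>\<^bsub>T\<^esub> \<beta> (x', y)"
    and b2: "\<And>x y y'. \<lbrakk>x \<in> carrier M; y \<in> carrier N; y' \<in> carrier N\<rbrakk> \<Longrightarrow>
      \<beta> (x, y \<oplus>\<^bsub>N\<^esub> y') = \<beta> (x, y) \<oplus>\<^bsub>T\<^esub> \<beta> (x, y')"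
    and b3: "\<And>r x y. \<lbrakk>r \<in> carrier R; x \<in> carrier M; y \<in> carrier N\<rbrakk> \<Longrightarrow>
      \<beta> (r \<odot>\<^bsub>M\<^esub> x, y) = \<beta> (x, r \<odot>\<^bsub>N\<^esub> y)"
    and x: "x \<in> carrier M" and y: "y \<in> carrier N"
  shows "tensor_lift T \<beta> (tensor_relations R M N #>\<^bsub>tensor_free M N\<^esub> frag_of (x, y)) = \<beta> (x, y)"
proof -
  interpret T: abelian_group T by fact
  interpret M: module R M by fact
  interpret N: module R N by fact
  let ?C = "carrier M \<times> carrier N"
  define h where "h c = (\<Oplus>\<^bsub>T\<^esub>p\<in>Poly_Mapping.keys c. add_pow T (Poly_Mapping.lookup c p) (\<beta> p))" for c :: "'c \<times> 'e \<Rightarrow>\<^sub>0 int"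
  have bc: "\<beta> p \<in> carrier T" if "p \<in> ?C" for p using that b by auto
  have hS: "h c = (\<Oplus>\<^bsub>T\<^esub>p\<in>A. add_pow T (Poly_Mapping.lookup c p) (\<beta> p))"
    if A: "finite A" "Poly_Mapping.keys c \<subseteq> A" "A \<subseteq> ?C" for c A
  proof -
    have "\<beta> p \<in> carrier T" if "p \<in> A" for p using that A(3) bc by blast
    then show ?thesis
      unfolding h_def
      by (intro T.add.finprod_mono_neutral_cong_left)
        (use A(1,2) in \<open>auto simp: in_keys_iff add_pow_def[of T "0 :: int"]\<close>)
  qed
  have hom: "h \<in> hom (tensor_free M N) (add_monoid T)"
  proof (rule homI)
    fix c d assume c: "c \<in> carrier (tensor_free M N)" and d: "d \<in> carrier (tensor_free M N)"
    let ?A = "Poly_Mapping.keys c \<union> Poly_Mapping.keys d"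
    have A: "finite ?A" "?A \<subseteq> ?C" using c d by auto
    have "h (c + d) = (\<Oplus>\<^bsub>T\<^esub>p\<in>?A. add_pow T (Poly_Mapping.lookup c p) (\<beta> p) \<oplus>\<^bsub>T\<^esub> add_pow T (Poly_Mapping.lookup d p) (\<beta> p))"
      unfolding hS[OF A(1) keys_add A(2)]
      by (rule T.add.finprod_cong')
       (use A bc in \<open>auto simp: lookup_add T.add.int_pow_mult subset_iff\<close>)
    also have "\<dots> = h c \<oplus>\<^bsub>T\<^esub> h d"
      unfolding hS[OF A(1) Un_upper1 A(2)] hS[OF A(1) Un_upper2 A(2)]
      by (rule T.finsum_addf) (use A bc in \<open>auto simp: subset_iff\<close>)
    finally show "h (c \<otimes>\<^bsub>tensor_free M N\<^esub> d) = h c \<otimes>\<^bsub>add_monoid T\<^esub> h d" by simp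
  next
    fix c assume "c \<in> carrier (tensor_free M N)"
    then show "h c \<in> carrier (add_monoid T)"
      unfolding h_def using bc by (auto intro!: T.finsum_closed)
  qed
  interpret h: group_hom "tensor_free M N" "add_monoid T" h
    using hom T.a_group by (simp add: group_hom_def group_hom_axioms_def)
  have hof: "h (frag_of p) = \<beta> p" if "p \<in> ?C" for p
    unfolding h_def using bc[OF that] by (simp add: keys_frag_of)
  have hdiff: "h (c - d) = h c \<ominus>\<^bsub>T\<^esub> h d"
    if "c \<in> carrier (tensor_free M N)" "d \<in> carrier (tensor_free M N)" for c d
    using h.hom_mult[of c "-d"] h.hom_inv[OF that(2)] that
    by (simp add: a_minus_def a_inv_def)
  have keys: "Poly_Mapping.keys (frag_of p - frag_of q) \<subseteq> ?C" if "p \<in> ?C" "q \<in> ?C" for p q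
    using keys_diff[of "frag_of p" "frag_of q"] that by (auto simp: keys_frag_of)
  \<comment> \<open>The first two families of relations are sent to expressions of this shape.\<close>
  have cancel: "a \<oplus>\<^bsub>T\<^esub> b \<ominus>\<^bsub>T\<^esub> a \<ominus>\<^bsub>T\<^esub> b = \<zero>\<^bsub>T\<^esub>" if "a \<in> carrier T" "b \<in> carrier T" for a b
    using that by (simp add: T.minus_eq T.a_comm[of a b] T.a_assoc T.r_neg)
  have rel: "h d = \<zero>\<^bsub>T\<^esub>" if "d \<in> tensor_relations R M N" for d
  proof -
    have "h d \<in> {\<zero>\<^bsub>T\<^esub>}"
      by (rule tensor_relations_hom_image[OF M N T.a_group _ hom _ _ _ that])
        (use T.add.triv_subgroup in \<open>auto simp: hdiff hof keys b b1 b2 b3 cancel T.minus_eq[of z z for z] T.r_neg\<close>)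
    then show ?thesis by simp
  qed
  let ?c = "frag_of (x, y)"
  have c: "?c \<in> carrier (tensor_free M N)" using x y by simp
  note Q = tensor_relations_subgroup[OF M N]
  have const: "h d = \<beta> (x, y)" if d: "d \<in> tensor_relations R M N #>\<^bsub>tensor_free M N\<^esub> ?c" for d
  proof -
    obtain q where q: "q \<in> tensor_relations R M N" "d = q \<otimes>\<^bsub>tensor_free M N\<^esub> ?c"
      using d by (auto simp: r_coset_def)
    have "h d = h q \<oplus>\<^bsub>T\<^esub> h ?c"
      unfolding q(2) using h.hom_mult[OF subgroup.mem_carrier[OF Q q(1)] c] by simp
    then show ?thesis using rel[OF q(1)] hof[of "(x, y)"] x y b by simp
  qed
  have "?c \<in> tensor_relations R M N #>\<^bsub>tensor_free M N\<^esub> ?c"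
    using group.rcos_self[OF _ c Q] by simp
  then have "h ` (tensor_relations R M N #>\<^bsub>tensor_free M N\<^esub> ?c) = {\<beta> (x, y)}"
    by (subst image_cong[OF refl const]) (auto simp: image_constant_conv)
  then show ?thesis unfolding tensor_lift_def h_def by simp
qed

section \<open>Base change along a surjective ring homomorphism\<close>

text \<open>For surjective \<open>\<phi>\<close>, every element of \<open>S \<otimes>\<^sub>R N\<close> has the form \<open>1 \<otimes> x\<close>. All computations in the base
change are made on these elements, called \<open>one_tensor x\<close> below.\<close>

locale surj_base_change = ring_hom_cring R S \<phi> + N?: module R N
  for R :: "('r, 'x) ring_scheme" and S :: "('s, 'y) ring_scheme" and \<phi> :: "'r \<Rightarrow> 's"
    and N :: "('r, 'n, 'z) module_scheme" +
  assumes surj: "\<phi> ` carrier R = carrier S"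
begin

abbreviation "RS \<equiv> restrict_scalars \<phi> (regular_module S)"
abbreviation "F \<equiv> tensor_free RS N"
abbreviation "Q \<equiv> tensor_relations R RS N"

definition one_tensor :: "'n \<Rightarrow> ('s \<times> 'n \<Rightarrow>\<^sub>0 int) set" where
  "one_tensor x = Q #>\<^bsub>F\<^esub> frag_of (\<one>\<^bsub>S\<^esub>, x)"

lemma module_RS: "module R RS"
  by (rule module_restrict_scalars[OF R.is_cring homh S.module_regular_module])

lemma rels_subgroup: "subgroup Q F"
  by (rule tensor_relations_subgroup[OF module_RS N.module_axioms])

lemma rels_add: "c \<in> Q \<Longrightarrow> d \<in> Q \<Longrightarrow> c + d \<in> Q"
  using subgroup.m_closed[OF rels_subgroup] by simp

lemma rels_minus: "c \<in> Q \<Longrightarrow> - c \<in> Q"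
  using subgroup.m_inv_closed[OF rels_subgroup, of c] subgroup.mem_carrier[OF rels_subgroup, of c] by simp

lemma rels_diff: "c \<in> Q \<Longrightarrow> d \<in> Q \<Longrightarrow> c - d \<in> Q"
  using rels_add[of c "- d"] rels_minus[of d] by simp

lemma frag_in_F: "s \<in> carrier S \<Longrightarrow> x \<in> carrier N \<Longrightarrow> frag_of (s, x) \<in> carrier F"
  by simp

lemma one_tensor_eq_iff:
  "x \<in> carrier N \<Longrightarrow> y \<in> carrier N \<Longrightarrow>
    one_tensor x = one_tensor y \<longleftrightarrow> frag_of (\<one>\<^bsub>S\<^esub>, x) - frag_of (\<one>\<^bsub>S\<^esub>, y) \<in> Q"
  unfolding one_tensor_def
  by (rule tensor_coset_eq_iff[OF module_RS N.module_axioms]) (simp_all add: frag_in_F)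

lemma rel_one_add:
  "x \<in> carrier N \<Longrightarrow> y \<in> carrier N \<Longrightarrow>
    frag_of (\<one>\<^bsub>S\<^esub>, x \<oplus>\<^bsub>N\<^esub> y) - frag_of (\<one>\<^bsub>S\<^esub>, x) - frag_of (\<one>\<^bsub>S\<^esub>, y) \<in> Q"
  by (rule tensor_relations_add_right) simp_all

lemma rel_scalar:
  "r \<in> carrier R \<Longrightarrow> x \<in> carrier N \<Longrightarrow>
    frag_of (\<phi> r, x) - frag_of (\<one>\<^bsub>S\<^esub>, r \<odot>\<^bsub>N\<^esub> x) \<in> Q"
  using tensor_relations_smult[of r R "\<one>\<^bsub>S\<^esub>" RS x N] by simp

lemma rel_one_diff:
  assumes x: "x \<in> carrier N" and y: "y \<in> carrier N"
  shows "(frag_of (\<one>\<^bsub>S\<^esub>, x) - frag_of (\<one>\<^bsub>S\<^esub>, y)) - frag_of (\<one>\<^bsub>S\<^esub>, x \<ominus>\<^bsub>N\<^esub> y) \<in> Q"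
proof -
  have "(x \<ominus>\<^bsub>N\<^esub> y) \<oplus>\<^bsub>N\<^esub> y = x"
    using x y by (simp add: a_minus_def N.M.a_assoc N.M.l_neg)
  then show ?thesis
    using rel_one_add[of "x \<ominus>\<^bsub>N\<^esub> y" y] x y by (simp add: algebra_simps)
qed

lemma rel_one_zero: "frag_of (\<one>\<^bsub>S\<^esub>, \<zero>\<^bsub>N\<^esub>) \<in> Q"
  using rels_minus[OF rel_one_add[of "\<zero>\<^bsub>N\<^esub>" "\<zero>\<^bsub>N\<^esub>"]] by simp

lemma rel_zero_left:
  assumes "x \<in> carrier N"
  shows "frag_of (\<zero>\<^bsub>S\<^esub>, x) \<in> Q"
  using rels_minus[OF tensor_relations_add_left[of "\<zero>\<^bsub>S\<^esub>" RS "\<zero>\<^bsub>S\<^esub>" x N R]] assms by simp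

text \<open>Scalars move to the right-hand factor: \<open>\<phi>(r) \<otimes> x = 1 \<otimes> rx\<close>, and every element of \<open>S\<close> is some \<open>\<phi>(r)\<close>.\<close>

lemma rel_to_one_tensor:
  assumes "c \<in> carrier F"
  shows "\<exists>x\<in>carrier N. c - frag_of (\<one>\<^bsub>S\<^esub>, x) \<in> Q"
proof -
  have "Poly_Mapping.keys c \<subseteq> carrier RS \<times> carrier N" using assms by simp
  then show ?thesis
  proof (rule free_Abelian_group_induct)
    show "\<exists>x\<in>carrier N. 0 - frag_of (\<one>\<^bsub>S\<^esub>, x) \<in> Q"
      using rels_minus[OF rel_one_zero] by (intro bexI[of _ "\<zero>\<^bsub>N\<^esub>"]) simp_all
  next
    fix c d
    assume "\<exists>x\<in>carrier N. c - frag_of (\<one>\<^bsub>S\<^esub>, x) \<in> Q" "\<exists>x\<in>carrier N. d - frag_of (\<one>\<^bsub>S\<^esub>, x) \<in> Q"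
    then obtain x y where x: "x \<in> carrier N" "c - frag_of (\<one>\<^bsub>S\<^esub>, x) \<in> Q"
      and y: "y \<in> carrier N" "d - frag_of (\<one>\<^bsub>S\<^esub>, y) \<in> Q" by blast
    have "(c - frag_of (\<one>\<^bsub>S\<^esub>, x)) - (d - frag_of (\<one>\<^bsub>S\<^esub>, y)) +
      ((frag_of (\<one>\<^bsub>S\<^esub>, x) - frag_of (\<one>\<^bsub>S\<^esub>, y)) - frag_of (\<one>\<^bsub>S\<^esub>, x \<ominus>\<^bsub>N\<^esub> y)) \<in> Q"
      by (intro rels_add rels_diff x y rel_one_diff)
    then have "(c - d) - frag_of (\<one>\<^bsub>S\<^esub>, x \<ominus>\<^bsub>N\<^esub> y) \<in> Q" by (simp add: algebra_simps)
    then show "\<exists>x\<in>carrier N. c - d - frag_of (\<one>\<^bsub>S\<^esub>, x) \<in> Q" using x y by blast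
  next
    fix a assume "a \<in> carrier RS \<times> carrier N"
    then obtain s x where a: "a = (s, x)" "s \<in> carrier S" "x \<in> carrier N" by auto
    then obtain r where "r \<in> carrier R" "s = \<phi> r" using surj by blast
    then show "\<exists>x\<in>carrier N. frag_of a - frag_of (\<one>\<^bsub>S\<^esub>, x) \<in> Q"
      using rel_scalar[of r x] a by (intro bexI[of _ "r \<odot>\<^bsub>N\<^esub> x"]) auto
  qed
qed

lemma carrier_base_change: "carrier (base_change R S \<phi> N) = one_tensor ` carrier N"
proof -
  have "carrier (base_change R S \<phi> N) = (\<lambda>c. Q #>\<^bsub>F\<^esub> c) ` carrier F"
    by (auto simp: base_change_def Let_def tensor_group_def FactGroup_def RCOSETS_def)
  also have "\<dots> = one_tensor ` carrier N"
  proof (intro equalityI image_subsetI)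
    fix c assume c: "c \<in> carrier F"
    then obtain x where "x \<in> carrier N" "c - frag_of (\<one>\<^bsub>S\<^esub>, x) \<in> Q"
      using rel_to_one_tensor by blast
    then show "Q #>\<^bsub>F\<^esub> c \<in> one_tensor ` carrier N"
      using tensor_coset_eq_iff[OF module_RS N.module_axioms c frag_in_F[of "\<one>\<^bsub>S\<^esub>" x]]
      by (auto simp: one_tensor_def)
  next
    fix x assume "x \<in> carrier N"
    then show "one_tensor x \<in> (\<lambda>c. Q #>\<^bsub>F\<^esub> c) ` carrier F"
      unfolding one_tensor_def by (intro imageI frag_in_F) simp_all
  qed
  finally show ?thesis .
qed

lemma one_tensor_add:
  assumes x: "x \<in> carrier N" and y: "y \<in> carrier N"
  shows "one_tensor x \<oplus>\<^bsub>base_change R S \<phi> N\<^esub> one_tensor y = one_tensor (x \<oplus>\<^bsub>N\<^esub> y)"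
proof -
  have nor: "Q \<lhd> F"
    by (rule comm_group.normal_iff_subgroup[THEN iffD2, OF abelian_free_Abelian_group rels_subgroup])
  have "one_tensor x \<oplus>\<^bsub>base_change R S \<phi> N\<^esub> one_tensor y = one_tensor x <#>\<^bsub>F\<^esub> one_tensor y"
    by (simp add: base_change_def Let_def tensor_group_def FactGroup_def)
  also have "\<dots> = Q #>\<^bsub>F\<^esub> (frag_of (\<one>\<^bsub>S\<^esub>, x) + frag_of (\<one>\<^bsub>S\<^esub>, y))"
    unfolding one_tensor_def using normal.rcos_sum[OF nor frag_in_F frag_in_F, of "\<one>\<^bsub>S\<^esub>" x "\<one>\<^bsub>S\<^esub>" y] x y by simp
  also have "\<dots> = one_tensor (x \<oplus>\<^bsub>N\<^esub> y)"
  proof -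
    have "frag_of (\<one>\<^bsub>S\<^esub>, x) + frag_of (\<one>\<^bsub>S\<^esub>, y) \<in> carrier F"
      using group.is_monoid[THEN monoid.m_closed, OF group_free_Abelian_group frag_in_F frag_in_F, of "\<one>\<^bsub>S\<^esub>" x "\<one>\<^bsub>S\<^esub>" y] x y by simp
    moreover have "frag_of (\<one>\<^bsub>S\<^esub>, x) + frag_of (\<one>\<^bsub>S\<^esub>, y) - frag_of (\<one>\<^bsub>S\<^esub>, x \<oplus>\<^bsub>N\<^esub> y) \<in> Q"
      using rels_minus[OF rel_one_add[OF x y]] by (simp add: algebra_simps)
    ultimately show ?thesis
      using tensor_coset_eq_iff[OF module_RS N.module_axioms _ frag_in_F[of "\<one>\<^bsub>S\<^esub>" "x \<oplus>\<^bsub>N\<^esub> y"]] x y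
      by (simp add: one_tensor_def)
  qed
  finally show ?thesis .
qed

lemma tensor_map_one_tensor:
  assumes N': "module R N'" and M': "module R M'" and f: "f \<in> module_hom R RS M'" and g: "g \<in> module_hom R N N'"
    and x: "x \<in> carrier N"
  shows "tensor_map R M' N' f g (one_tensor x) =
    tensor_relations R M' N' #>\<^bsub>tensor_free M' N'\<^esub> frag_of (f \<one>\<^bsub>S\<^esub>, g x)"
  using tensor_map_coset[OF module_RS N.module_axioms M' N' f g frag_in_F[of "\<one>\<^bsub>S\<^esub>" x]] x
  by (simp add: one_tensor_def)

lemma id_module_hom: "(\<lambda>y. y) \<in> module_hom R N N"
  by (auto simp: module_hom_def hom_def)

lemma one_tensor_smult:
  assumes r: "r \<in> carrier R" and x: "x \<in> carrier N"
  shows "\<phi> r \<odot>\<^bsub>base_change R S \<phi> N\<^esub> one_tensor x = one_tensor (r \<odot>\<^bsub>N\<^esub> x)"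
proof -
  have hom: "(\<lambda>t. \<phi> r \<otimes>\<^bsub>S\<^esub> t) \<in> module_hom R RS RS"
    using r by (auto simp: module_hom_def hom_def S.r_distr S.m_lcomm)
  have "\<phi> r \<odot>\<^bsub>base_change R S \<phi> N\<^esub> one_tensor x = tensor_map R RS N (\<lambda>t. \<phi> r \<otimes>\<^bsub>S\<^esub> t) (\<lambda>y. y) (one_tensor x)"
    by (simp add: base_change_def Let_def)
  also have "\<dots> = Q #>\<^bsub>F\<^esub> frag_of (\<phi> r, x)"
    using tensor_map_one_tensor[OF N.module_axioms module_RS hom id_module_hom x] r by simp
  also have "\<dots> = one_tensor (r \<odot>\<^bsub>N\<^esub> x)"
    using tensor_coset_eq_iff[OF module_RS N.module_axioms frag_in_F[of "\<phi> r" x] frag_in_F[of "\<one>\<^bsub>S\<^esub>" "r \<odot>\<^bsub>N\<^esub> x"]]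
      rel_scalar[OF r x] r x
    by (simp add: one_tensor_def)
  finally show ?thesis .
qed

text \<open>The identification of \<open>S \<otimes>\<^sub>R N\<close> with \<open>N / JN\<close>, where \<open>J\<close> is the kernel of \<open>\<phi>\<close>. If \<open>\<phi>(r) = 0\<close> then
\<open>1 \<otimes> rx = \<phi>(r) \<otimes> x = 0\<close>, which gives one direction. For the other, choose a set-theoretic section
\<open>\<sigma>\<close> of \<open>\<phi>\<close>; the map \<open>s \<otimes> x \<mapsto> \<sigma>(s)x\<close> is biadditive and balanced modulo \<open>JN\<close>, because two preimages of
the same element of \<open>S\<close> differ by an element of \<open>J\<close>.\<close>

lemma one_tensor_eq_iff_kernel:
  assumes x: "x \<in> carrier N" and y: "y \<in> carrier N"
  shows "one_tensor x = one_tensor y \<longleftrightarrow>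
    x \<ominus>\<^bsub>N\<^esub> y \<in> smult_span N {r \<in> carrier R. \<phi> r = \<zero>\<^bsub>S\<^esub>} (carrier N)"
proof -
  let ?J = "{r \<in> carrier R. \<phi> r = \<zero>\<^bsub>S\<^esub>}"
  let ?H = "smult_span N ?J (carrier N)"
  have JR: "?J \<subseteq> carrier R" by blast
  note H = N.smult_span_subgroup[OF JR order_refl]
  define \<sigma> where "\<sigma> s = (SOME r. r \<in> carrier R \<and> \<phi> r = s)" for s
  have \<sigma>: "\<sigma> s \<in> carrier R \<and> \<phi> (\<sigma> s) = s" if "s \<in> carrier S" for s
  proof -
    have "\<exists>r. r \<in> carrier R \<and> \<phi> r = s" using that unfolding surj[symmetric] by blast
    then show ?thesis unfolding \<sigma>_def by (rule someI_ex)
  qed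
  have "(\<lambda>p. \<sigma> (fst p) \<odot>\<^bsub>N\<^esub> snd p) ` (carrier RS \<times> carrier N) \<subseteq> carrier (add_monoid N)"
    using \<sigma> by auto
  from comm_group.free_Abelian_group_universal[OF N.M.a_comm_group this]
  obtain h where h: "h \<in> hom F (add_monoid N)"
    "\<And>p. p \<in> carrier RS \<times> carrier N \<Longrightarrow> h (frag_of p) = \<sigma> (fst p) \<odot>\<^bsub>N\<^esub> snd p"
    by metis
  interpret h: group_hom F "add_monoid N" h
    using h(1) N.M.a_group by (simp add: group_hom_def group_hom_axioms_def)
  have hof: "h (frag_of (s, z)) = \<sigma> s \<odot>\<^bsub>N\<^esub> z" if "s \<in> carrier S" "z \<in> carrier N" for s z
    using h(2)[of "(s, z)"] that by simp
  have hdiff: "h (c - d) = h c \<ominus>\<^bsub>N\<^esub> h d" if "c \<in> carrier F" "d \<in> carrier F" for c d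
    using h.hom_mult[of c "-d"] h.hom_inv[OF that(2)] that by (simp add: a_minus_def a_inv_def)
  have two: "frag_of p - frag_of q \<in> carrier F"
    if "p \<in> carrier S \<times> carrier N" "q \<in> carrier S \<times> carrier N" for p q
    using keys_diff[of "frag_of p" "frag_of q"] that by (auto simp: keys_frag_of)
  \<comment> \<open>For the relations of left additivity and of balance: two preimages of one element of \<open>S\<close> act
    equally modulo \<open>JN\<close>.\<close>
  have scal: "r \<odot>\<^bsub>N\<^esub> z \<ominus>\<^bsub>N\<^esub> r' \<odot>\<^bsub>N\<^esub> z \<in> ?H" if "r \<in> carrier R" "r' \<in> carrier R" "\<phi> r = \<phi> r'" "z \<in> carrier N" for r r' z
  proof -
    have "r \<odot>\<^bsub>N\<^esub> z \<ominus>\<^bsub>N\<^esub> r' \<odot>\<^bsub>N\<^esub> z = (r \<ominus>\<^bsub>R\<^esub> r') \<odot>\<^bsub>N\<^esub> z"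
      using that by (simp add: a_minus_def N.smult_l_distr N.smult_l_minus)
    moreover have "r \<ominus>\<^bsub>R\<^esub> r' \<in> ?J" using that by (simp add: a_minus_def S.r_neg)
    ultimately show ?thesis using N.smult_span_gen that(4) by metis
  qed
  have hQ: "h c \<in> ?H" if c: "c \<in> Q" for c
  proof (rule tensor_relations_hom_image[OF module_RS N.module_axioms N.M.a_group H h(1) _ _ _ c])
    fix s s' z assume "s \<in> carrier RS" "s' \<in> carrier RS" and z: "z \<in> carrier N"
    then have s: "s \<in> carrier S" "s' \<in> carrier S" by simp_all
    have "h (frag_of (s \<oplus>\<^bsub>RS\<^esub> s', z) - frag_of (s, z) - frag_of (s', z)) =
      \<sigma> (s \<oplus>\<^bsub>S\<^esub> s') \<odot>\<^bsub>N\<^esub> z \<ominus>\<^bsub>N\<^esub> \<sigma> s \<odot>\<^bsub>N\<^esub> z \<ominus>\<^bsub>N\<^esub> \<sigma> s' \<odot>\<^bsub>N\<^esub> z"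
      using s z two by (simp add: hdiff hof del: carrier_free_Abelian_group_iff)
    also have "\<dots> = \<sigma> (s \<oplus>\<^bsub>S\<^esub> s') \<odot>\<^bsub>N\<^esub> z \<ominus>\<^bsub>N\<^esub> (\<sigma> s \<oplus>\<^bsub>R\<^esub> \<sigma> s') \<odot>\<^bsub>N\<^esub> z"
      using s z \<sigma>[of s] \<sigma>[of s'] \<sigma>[of "s \<oplus>\<^bsub>S\<^esub> s'"]
      by (simp add: N.smult_l_distr a_minus_def N.M.minus_add N.M.a_assoc)
    also have "\<dots> \<in> ?H" using s z \<sigma>[of s] \<sigma>[of s'] \<sigma>[of "s \<oplus>\<^bsub>S\<^esub> s'"] by (intro scal) simp_all
    finally show "h (frag_of (s \<oplus>\<^bsub>RS\<^esub> s', z) - frag_of (s, z) - frag_of (s', z)) \<in> ?H" .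
  next
    fix s z z' assume "s \<in> carrier RS" and z: "z \<in> carrier N" "z' \<in> carrier N"
    then have s: "s \<in> carrier S" by simp
    have "h (frag_of (s, z \<oplus>\<^bsub>N\<^esub> z') - frag_of (s, z) - frag_of (s, z')) =
      \<sigma> s \<odot>\<^bsub>N\<^esub> (z \<oplus>\<^bsub>N\<^esub> z') \<ominus>\<^bsub>N\<^esub> \<sigma> s \<odot>\<^bsub>N\<^esub> z \<ominus>\<^bsub>N\<^esub> \<sigma> s \<odot>\<^bsub>N\<^esub> z'"
      using s z two by (simp add: hdiff hof del: carrier_free_Abelian_group_iff)
    also have "\<dots> = \<zero>\<^bsub>N\<^esub>"
      using s z \<sigma>[of s]
      by (simp add: N.smult_r_distr a_minus_def N.M.a_assoc N.M.a_comm[of "\<sigma> s \<odot>\<^bsub>N\<^esub> z"] N.M.r_neg)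
    finally show "h (frag_of (s, z \<oplus>\<^bsub>N\<^esub> z') - frag_of (s, z) - frag_of (s, z')) \<in> ?H"
      using subgroup.one_closed[OF H] by simp
  next
    fix r s z assume r: "r \<in> carrier R" and "s \<in> carrier RS" and z: "z \<in> carrier N"
    then have s: "s \<in> carrier S" by simp
    have "h (frag_of (r \<odot>\<^bsub>RS\<^esub> s, z) - frag_of (s, r \<odot>\<^bsub>N\<^esub> z)) =
      \<sigma> (\<phi> r \<otimes>\<^bsub>S\<^esub> s) \<odot>\<^bsub>N\<^esub> z \<ominus>\<^bsub>N\<^esub> (\<sigma> s \<otimes>\<^bsub>R\<^esub> r) \<odot>\<^bsub>N\<^esub> z"
      using r s z two \<sigma>[of s] by (simp add: hdiff hof N.smult_assoc1 del: carrier_free_Abelian_group_iff)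
    also have "\<dots> \<in> ?H"
      using r s z \<sigma>[of s] \<sigma>[of "\<phi> r \<otimes>\<^bsub>S\<^esub> s"] by (intro scal) (simp_all add: S.m_comm)
    finally show "h (frag_of (r \<odot>\<^bsub>RS\<^esub> s, z) - frag_of (s, r \<odot>\<^bsub>N\<^esub> z)) \<in> ?H" .
  qed
  show ?thesis
  proof
    assume "one_tensor x = one_tensor y"
    then have "h (frag_of (\<one>\<^bsub>S\<^esub>, x) - frag_of (\<one>\<^bsub>S\<^esub>, y)) \<in> ?H"
      using hQ one_tensor_eq_iff[OF x y] by blast
    then have "\<sigma> \<one>\<^bsub>S\<^esub> \<odot>\<^bsub>N\<^esub> x \<ominus>\<^bsub>N\<^esub> \<sigma> \<one>\<^bsub>S\<^esub> \<odot>\<^bsub>N\<^esub> y \<in> ?H"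
      using x y by (simp add: hdiff hof)
    moreover have "\<sigma> \<one>\<^bsub>S\<^esub> \<odot>\<^bsub>N\<^esub> x \<ominus>\<^bsub>N\<^esub> \<sigma> \<one>\<^bsub>S\<^esub> \<odot>\<^bsub>N\<^esub> y = \<sigma> \<one>\<^bsub>S\<^esub> \<odot>\<^bsub>N\<^esub> (x \<ominus>\<^bsub>N\<^esub> y)"
      using x y \<sigma>[of "\<one>\<^bsub>S\<^esub>"] by (simp add: a_minus_def N.smult_r_distr N.smult_r_minus)
    ultimately have 1: "\<sigma> \<one>\<^bsub>S\<^esub> \<odot>\<^bsub>N\<^esub> (x \<ominus>\<^bsub>N\<^esub> y) \<in> ?H" by simp
    have 2: "\<one>\<^bsub>R\<^esub> \<odot>\<^bsub>N\<^esub> (x \<ominus>\<^bsub>N\<^esub> y) \<ominus>\<^bsub>N\<^esub> \<sigma> \<one>\<^bsub>S\<^esub> \<odot>\<^bsub>N\<^esub> (x \<ominus>\<^bsub>N\<^esub> y) \<in> ?H"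
      using x y \<sigma>[of "\<one>\<^bsub>S\<^esub>"] by (intro scal) simp_all
    have "(\<one>\<^bsub>R\<^esub> \<odot>\<^bsub>N\<^esub> (x \<ominus>\<^bsub>N\<^esub> y) \<ominus>\<^bsub>N\<^esub> \<sigma> \<one>\<^bsub>S\<^esub> \<odot>\<^bsub>N\<^esub> (x \<ominus>\<^bsub>N\<^esub> y)) \<oplus>\<^bsub>N\<^esub> \<sigma> \<one>\<^bsub>S\<^esub> \<odot>\<^bsub>N\<^esub> (x \<ominus>\<^bsub>N\<^esub> y) \<in> ?H"
      using subgroup.m_closed[OF H 2 1] by simp
    then show "x \<ominus>\<^bsub>N\<^esub> y \<in> ?H"
      using x y \<sigma>[of "\<one>\<^bsub>S\<^esub>"] by (simp add: a_minus_def N.M.a_assoc N.M.l_neg)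
  next
    assume *: "x \<ominus>\<^bsub>N\<^esub> y \<in> ?H"
    let ?K = "{z \<in> carrier N. frag_of (\<one>\<^bsub>S\<^esub>, z) \<in> Q}"
    have "subgroup ?K (add_monoid N)"
    proof (rule N.M.add.subgroupI)
      show "?K \<noteq> {}" using rel_one_zero by blast
      show "\<ominus>\<^bsub>N\<^esub> a \<in> ?K" if "a \<in> ?K" for a
      proof -
        have "frag_of (\<one>\<^bsub>S\<^esub>, \<zero>\<^bsub>N\<^esub> \<ominus>\<^bsub>N\<^esub> a) \<in> Q"
          using rels_diff[OF rels_diff[OF rel_one_zero, of "frag_of (\<one>\<^bsub>S\<^esub>, a)"] rel_one_diff[of "\<zero>\<^bsub>N\<^esub>" a]] that
          by simp
        then show ?thesis using that by (simp add: a_minus_def)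
      qed
      show "a \<oplus>\<^bsub>N\<^esub> b \<in> ?K" if "a \<in> ?K" "b \<in> ?K" for a b
        using rels_add[OF rels_add[OF rel_one_add[of a b], of "frag_of (\<one>\<^bsub>S\<^esub>, a)"], of "frag_of (\<one>\<^bsub>S\<^esub>, b)"] that
        by simp
    qed auto
    moreover have "r \<odot>\<^bsub>N\<^esub> z \<in> ?K" if "r \<in> ?J" "z \<in> carrier N" for r z
      using rels_diff[OF rel_zero_left[of z] rel_scalar[of r z]] that by simp
    ultimately have "?H \<subseteq> ?K" by (rule N.smult_span_minimal)
    then have "frag_of (\<one>\<^bsub>S\<^esub>, x \<ominus>\<^bsub>N\<^esub> y) \<in> Q" using * by blast
    then show "one_tensor x = one_tensor y"
      using rels_add[OF rel_one_diff[OF x y], of "frag_of (\<one>\<^bsub>S\<^esub>, x \<ominus>\<^bsub>N\<^esub> y)"]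
      by (simp add: one_tensor_eq_iff[OF x y])
  qed
qed

end

section \<open>Adic systems as towers, and the limit as the inducing module\<close>

context cring
begin

lemma adic_ring_cring: "ideal I R \<Longrightarrow> cring (adic_ring R I k)"
  unfolding adic_ring_def by (rule ideal.quotient_is_cring[OF adic_power_ideal is_cring])

lemma adic_proj_ring_hom: "ideal I R \<Longrightarrow> adic_proj R I k \<in> ring_hom R (adic_ring R I k)"
  using ideal.rcos_ring_hom[OF adic_power_ideal, of I k]
  by (simp add: adic_ring_def adic_proj_def[abs_def])

lemma adic_proj_surj: "adic_proj R I k ` carrier R = carrier (adic_ring R I k)"
  by (auto simp: adic_ring_def adic_proj_def FactRing_def A_RCOSETS_def')

lemma adic_proj_eq_zero_iff:
  assumes "ideal I R" and "r \<in> carrier R"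
  shows "adic_proj R I k r = \<zero>\<^bsub>adic_ring R I k\<^esub> \<longleftrightarrow> r \<in> adic_power R I k"
proof -
  interpret P: ideal "adic_power R I k" R by (rule adic_power_ideal[OF assms(1)])
  show ?thesis
    using P.a_rcos_const[of r] P.a_rcos_self[OF assms(2)] assms(2)
    by (auto simp: adic_ring_def adic_proj_def FactRing_def)
qed

lemma adic_ring_trans_proj:
  assumes "ideal I R" and "r \<in> carrier R"
  shows "adic_ring_trans R I k (adic_proj R I (Suc k) r) = adic_proj R I k r"
proof -
  interpret P: ideal "adic_power R I k" R by (rule adic_power_ideal[OF assms(1)])
  interpret P': ideal "adic_power R I (Suc k)" R by (rule adic_power_ideal[OF assms(1)])
  have sub: "adic_power R I (Suc k) \<subseteq> adic_power R I k"
    unfolding adic_power_def by (rule ideal_pow_antimono[OF assms(1)]) simp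
  have "adic_power R I k +>\<^bsub>R\<^esub> s = adic_power R I k +>\<^bsub>R\<^esub> r" if "s \<in> adic_power R I (Suc k) +>\<^bsub>R\<^esub> r" for s
  proof -
    have "s \<in> adic_power R I k +>\<^bsub>R\<^esub> r"
      using that sub by (auto simp: a_r_coset_def r_coset_def)
    then show ?thesis
      using a_repr_independence[OF _ assms(2) P.a_subgroup] by simp
  qed
  moreover have "r \<in> adic_power R I (Suc k) +>\<^bsub>R\<^esub> r"
    by (rule P'.a_rcos_self[OF assms(2)])
  ultimately show ?thesis unfolding adic_ring_trans_def adic_proj_def by blast
qed

lemma adic_ring_trans_ring_hom:
  assumes "ideal I R"
  shows "adic_ring_trans R I k \<in> ring_hom (adic_ring R I (Suc k)) (adic_ring R I k)"
proof -
  let ?p = "adic_proj R I (Suc k)" and ?q = "adic_proj R I k"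
  note p = adic_proj_ring_hom[OF assms, of "Suc k"] and q = adic_proj_ring_hom[OF assms, of k]
  note T = adic_ring_trans_proj[OF assms, of _ k]
  have ex: "\<exists>r\<in>carrier R. a = ?p r" if "a \<in> carrier (adic_ring R I (Suc k))" for a
    using that unfolding adic_proj_surj[symmetric] by blast
  show ?thesis
  proof (rule ring_hom_memI)
    fix a b assume "a \<in> carrier (adic_ring R I (Suc k))" "b \<in> carrier (adic_ring R I (Suc k))"
    then obtain r s where r: "r \<in> carrier R" "a = ?p r" and s: "s \<in> carrier R" "b = ?p s"
      using ex by meson
    show "adic_ring_trans R I k a \<in> carrier (adic_ring R I k)"
      using r T ring_hom_closed[OF q] by simp
    show "adic_ring_trans R I k (a \<otimes>\<^bsub>adic_ring R I (Suc k)\<^esub> b) =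
        adic_ring_trans R I k a \<otimes>\<^bsub>adic_ring R I k\<^esub> adic_ring_trans R I k b"
      using r s T[of "r \<otimes> s"] T[of r] T[of s] by (simp add: ring_hom_mult[OF p] ring_hom_mult[OF q])
    show "adic_ring_trans R I k (a \<oplus>\<^bsub>adic_ring R I (Suc k)\<^esub> b) =
        adic_ring_trans R I k a \<oplus>\<^bsub>adic_ring R I k\<^esub> adic_ring_trans R I k b"
      using r s T[of "r \<oplus> s"] T[of r] T[of s] by (simp add: ring_hom_add[OF p] ring_hom_add[OF q])
  next
    show "adic_ring_trans R I k \<one>\<^bsub>adic_ring R I (Suc k)\<^esub> = \<one>\<^bsub>adic_ring R I k\<^esub>"
      using T[of \<one>] by (simp add: ring_hom_one[OF p] ring_hom_one[OF q])
  qed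
qed

lemma adic_ring_trans_surj:
  assumes "ideal I R"
  shows "adic_ring_trans R I k ` carrier (adic_ring R I (Suc k)) = carrier (adic_ring R I k)"
  unfolding adic_proj_surj[symmetric] image_image
  by (rule image_cong) (simp_all add: adic_ring_trans_proj[OF assms])

text \<open>Under \<open>A\<^sub>k \<otimes> M\<^sub>k\<^sub>+\<^sub>1 \<rightarrow> M\<^sub>k\<close> the element \<open>1 \<otimes> x\<close> is sent to \<open>\<tau>\<^sub>k(x)\<close>. Since all elements have this form,
bijectivity says that \<open>\<tau>\<^sub>k\<close> is surjective and that \<open>\<tau>\<^sub>k(x) = 0\<close> forces \<open>1 \<otimes> x = 0\<close>, that is, that \<open>x\<close> lies in
the multiple of \<open>M\<^sub>k\<^sub>+\<^sub>1\<close> by the kernel of \<open>A\<^sub>k\<^sub>+\<^sub>1 \<rightarrow> A\<^sub>k\<close>. That kernel is the image of \<open>I\<^bsup>k+1\<^esup>\<close>.\<close>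

lemma adic_system_transitions:
  assumes I: "ideal I R" and sys: "adic_system R I M \<tau>"
  defines "L \<equiv> \<lambda>k. restrict_scalars (adic_proj R I k) (M k)"
  shows "\<tau> k ` carrier (M (Suc k)) = carrier (M k)"
    and "\<lbrakk>x \<in> carrier (M (Suc k)); \<tau> k x = \<zero>\<^bsub>M k\<^esub>\<rbrakk> \<Longrightarrow>
      x \<in> smult_span (L (Suc k)) (adic_power R I k) (carrier (L (Suc k)))"
proof -
  have M: "module (adic_ring R I k) (M k)" for k
    using sys unfolding adic_system_def by blast
  have \<tau>: "\<tau> k \<in> module_hom R (L (Suc k)) (L k)"
    using sys unfolding adic_system_def L_def by blast
  let ?A = "adic_ring R I (Suc k)" and ?B = "adic_ring R I k" and ?\<phi> = "adic_ring_trans R I k"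
  let ?p = "adic_proj R I (Suc k)" and ?q = "adic_proj R I k"
  interpret B: surj_base_change ?A ?B ?\<phi> "M (Suc k)"
    by (intro surj_base_change.intro ring_hom_cring.intro ring_hom_cring_axioms.intro
        surj_base_change_axioms.intro adic_ring_cring[OF I] adic_ring_trans_ring_hom[OF I]
        adic_ring_trans_surj[OF I] M)
  interpret Mk: module ?B "M k" by (rule M)
  let ?lift = "tensor_lift (M k) (\<lambda>(a, x). a \<odot>\<^bsub>M k\<^esub> \<tau> k x)"
  have bij: "bij_betw ?lift (carrier (base_change ?A ?B ?\<phi> (M (Suc k)))) (carrier (M k))"
    using sys unfolding adic_system_def by blast
  have ex: "\<exists>r\<in>carrier R. a = ?p r" if "a \<in> carrier ?A" for a
    using that unfolding adic_proj_surj[symmetric] by blast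
  have closed: "\<tau> k x \<in> carrier (M k)" if "x \<in> carrier (M (Suc k))" for x
    using \<tau> that by (auto simp: module_hom_def hom_def L_def)
  have add: "\<tau> k (x \<oplus>\<^bsub>M (Suc k)\<^esub> y) = \<tau> k x \<oplus>\<^bsub>M k\<^esub> \<tau> k y"
    if "x \<in> carrier (M (Suc k))" "y \<in> carrier (M (Suc k))" for x y
    using \<tau> that by (auto simp: module_hom_def hom_def L_def)
  have smult: "\<tau> k (a \<odot>\<^bsub>M (Suc k)\<^esub> x) = ?\<phi> a \<odot>\<^bsub>M k\<^esub> \<tau> k x"
    if a: "a \<in> carrier ?A" and x: "x \<in> carrier (M (Suc k))" for a x
  proof -
    obtain r where r: "r \<in> carrier R" "a = ?p r" using ex[OF a] by blast
    have "\<tau> k (?p r \<odot>\<^bsub>M (Suc k)\<^esub> x) = ?q r \<odot>\<^bsub>M k\<^esub> \<tau> k x"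
      using \<tau> r(1) x by (simp add: module_hom_def L_def)
    then show ?thesis using r adic_ring_trans_proj[OF I r(1)] by simp
  qed
  have lift: "?lift (B.one_tensor x) = \<tau> k x" if x: "x \<in> carrier (M (Suc k))" for x
    unfolding B.one_tensor_def
    by (subst tensor_lift_pure[OF B.module_RS M Mk.M.abelian_group_axioms])
      (use x closed in \<open>auto simp: add smult Mk.smult_l_distr Mk.smult_r_distr
        Mk.smult_assoc1[symmetric] B.S.m_comm\<close>)
  show "\<tau> k ` carrier (M (Suc k)) = carrier (M k)"
    using bij_betw_imp_surj_on[OF bij] lift by (simp add: B.carrier_base_change image_image)
  show "x \<in> smult_span (L (Suc k)) (adic_power R I k) (carrier (L (Suc k)))"
    if x: "x \<in> carrier (M (Suc k))" and zero: "\<tau> k x = \<zero>\<^bsub>M k\<^esub>"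
  proof -
    have z: "\<zero>\<^bsub>M (Suc k)\<^esub> \<in> carrier (M (Suc k))" by (rule B.N.M.zero_closed)
    have "\<tau> k \<zero>\<^bsub>M (Suc k)\<^esub> = \<zero>\<^bsub>M k\<^esub>"
      using add[OF z z] closed[OF z] by simp
    then have "?lift (B.one_tensor x) = ?lift (B.one_tensor \<zero>\<^bsub>M (Suc k)\<^esub>)"
      using zero lift[OF x] lift[OF z] by simp
    then have "B.one_tensor x = B.one_tensor \<zero>\<^bsub>M (Suc k)\<^esub>"
      by (rule inj_onD[OF bij_betw_imp_inj_on[OF bij]]) (use x z in \<open>simp_all add: B.carrier_base_change\<close>)
    then have "x \<ominus>\<^bsub>M (Suc k)\<^esub> \<zero>\<^bsub>M (Suc k)\<^esub> \<in>
      smult_span (M (Suc k)) {a \<in> carrier ?A. ?\<phi> a = \<zero>\<^bsub>?B\<^esub>} (carrier (M (Suc k)))"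
      using B.one_tensor_eq_iff_kernel[OF x z] by simp
    moreover have "x \<ominus>\<^bsub>M (Suc k)\<^esub> \<zero>\<^bsub>M (Suc k)\<^esub> = x"
      by (rule B.N.M.minus_zero_right[OF x])
    moreover have "{a \<odot>\<^bsub>M (Suc k)\<^esub> y | a y. a \<in> {a \<in> carrier ?A. ?\<phi> a = \<zero>\<^bsub>?B\<^esub>} \<and> y \<in> carrier (M (Suc k))}
      = {r \<odot>\<^bsub>L (Suc k)\<^esub> y | r y. r \<in> adic_power R I k \<and> y \<in> carrier (L (Suc k))}"
    proof -
      have "{a \<in> carrier ?A. ?\<phi> a = \<zero>\<^bsub>?B\<^esub>} = ?p ` adic_power R I k"
      proof (intro equalityI subsetI)
        fix a assume a: "a \<in> {a \<in> carrier ?A. ?\<phi> a = \<zero>\<^bsub>?B\<^esub>}"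
        then obtain r where r: "r \<in> carrier R" "a = ?p r" using ex by blast
        then show "a \<in> ?p ` adic_power R I k"
          using a adic_ring_trans_proj[OF I r(1)] adic_proj_eq_zero_iff[OF I r(1)] by auto
      next
        fix a assume "a \<in> ?p ` adic_power R I k"
        then obtain r where r: "r \<in> adic_power R I k" "a = ?p r" by blast
        then have rR: "r \<in> carrier R" using ideal.Icarr[OF adic_power_ideal[OF I]] by blast
        then show "a \<in> {a \<in> carrier ?A. ?\<phi> a = \<zero>\<^bsub>?B\<^esub>}"
          using r adic_ring_trans_proj[OF I rR] adic_proj_eq_zero_iff[OF I rR]
            ring_hom_closed[OF adic_proj_ring_hom[OF I] rR] by auto
      qed
      then show ?thesis by (auto simp: L_def)
    qed
    moreover have "generate (add_monoid (L (Suc k))) K = generate (add_monoid (M (Suc k))) K" for K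
      by (rule generate_cong) (simp_all add: L_def)
    ultimately show ?thesis unfolding smult_span_def by simp
  qed
qed

lemma adic_system_tower:
  assumes I: "ideal I R" and sys: "adic_system R I M \<tau>"
  shows "adic_tower R I (\<lambda>k. restrict_scalars (adic_proj R I k) (M k)) \<tau>"
proof (intro adic_tower.intro adic_tower_axioms.intro)
  let ?L = "\<lambda>k. restrict_scalars (adic_proj R I k) (M k)"
  have M: "module (adic_ring R I k) (M k)" for k
    using sys unfolding adic_system_def by blast
  show "cring R" by (rule is_cring)
  show "ideal I R" by (rule I)
  show "module R (?L k)" for k
    by (rule module_restrict_scalars[OF is_cring adic_proj_ring_hom[OF I] M])
  show "\<tau> k \<in> module_hom R (?L (Suc k)) (?L k)" for k
    using sys unfolding adic_system_def by blast
  show "\<tau> k ` carrier (?L (Suc k)) = carrier (?L k)" for k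
    using adic_system_transitions(1)[OF I sys] by simp
  show "x \<in> smult_span (?L (Suc k)) (adic_power R I k) (carrier (?L (Suc k)))"
    if "x \<in> carrier (?L (Suc k))" "\<tau> k x = \<zero>\<^bsub>?L k\<^esub>" for x k
    using adic_system_transitions(2)[OF I sys, of x k] that by simp
  show "r \<odot>\<^bsub>?L k\<^esub> x = \<zero>\<^bsub>?L k\<^esub>" if r: "r \<in> adic_power R I k" and x: "x \<in> carrier (?L k)" for r x k
  proof -
    have "r \<in> carrier R" using ideal.Icarr[OF adic_power_ideal[OF I]] r by blast
    then have "adic_proj R I k r = \<zero>\<^bsub>adic_ring R I k\<^esub>" using adic_proj_eq_zero_iff[OF I] r by blast
    then show ?thesis using module.smult_l_null[OF M, of x k] x by simp
  qed
qed

end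

theorem corollary1p10:
  fixes R :: "('a, 'x) ring_scheme" and I :: "'a set"
    and M :: "nat \<Rightarrow> ('a set, 'm) module" and \<tau> :: "nat \<Rightarrow> 'm \<Rightarrow> 'm"
  assumes "cring R" and "ideal I R"
    and "\<exists>S. finite S \<and> S \<subseteq> carrier R \<and> I = Idl\<^bsub>R\<^esub> S"
    and "adic_system R I M \<tau>"
  shows "\<exists>N :: ('a, nat \<Rightarrow> 'm) module. module R N \<and>
    adic_isomorphic R I M \<tau> (induced_system R I N) (induced_trans R I N)"
proof -
  interpret R: cring R by fact
  let ?L = "\<lambda>k. restrict_scalars (adic_proj R I k) (M k)"
  interpret T: adic_tower R I ?L \<tau>
    by (rule R.adic_system_tower[OF assms(2,4)])
  let ?N = "limit_module ?L \<tau>"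
  interpret B: surj_base_change R "adic_ring R I k" "adic_proj R I k" ?N for k
    by (intro surj_base_change.intro ring_hom_cring.intro ring_hom_cring_axioms.intro
        surj_base_change_axioms.intro R.adic_ring_cring R.adic_proj_ring_hom
        R.adic_proj_surj T.module_limit assms(1,2))
  let ?t = "\<lambda>k. B.one_tensor k"
  have kernel: "{r \<in> carrier R. adic_proj R I k r = \<zero>\<^bsub>adic_ring R I k\<^esub>} = adic_power R I k" for k
    using R.adic_proj_eq_zero_iff[OF assms(2)] ideal.Icarr[OF R.adic_power_ideal[OF assms(2)]] by blast
  \<comment> \<open>The induced module at level \<open>k\<close> is \<open>N / I\<^bsup>k+1\<^esup> N\<close>, and \<open>I\<^bsup>k+1\<^esup> N\<close> is the kernel of the projection
    to level \<open>k\<close>, so \<open>1 \<otimes> x\<close> and the component of \<open>x\<close> at level \<open>k\<close> determine each other.\<close>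
  have t_eq: "?t k x = ?t k y \<longleftrightarrow> x k = y k" if x: "x \<in> carrier ?N" and y: "y \<in> carrier ?N" for k x y
  proof -
    have "?t k x = ?t k y \<longleftrightarrow> x \<ominus>\<^bsub>?N\<^esub> y \<in> smult_span ?N (adic_power R I k) (carrier ?N)"
      using B.one_tensor_eq_iff_kernel[OF x y, of k] unfolding kernel .
    also have "\<dots> \<longleftrightarrow> (x \<ominus>\<^bsub>?N\<^esub> y) k = \<zero>\<^bsub>?L k\<^esub>"
      using T.component_kernel[OF assms(3), of "x \<ominus>\<^bsub>?N\<^esub> y" k] T.component_span_zero[OF order_refl]
        T.N.M.minus_closed[OF x y] by blast
    also have "\<dots> \<longleftrightarrow> x k \<ominus>\<^bsub>?L k\<^esub> y k = \<zero>\<^bsub>?L k\<^esub>"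
      by (simp only: T.minus_component[OF x y])
    also have "\<dots> \<longleftrightarrow> x k = y k"
      by (rule T.L.M.minus_eq_zero_iff[OF T.limit_component[OF x] T.limit_component[OF y]])
    finally show ?thesis .
  qed
  \<comment> \<open>Both isomorphisms go through \<open>N\<close>: lift along one of two surjections with equal fibres, then apply
    the other.\<close>
  define f where "f k m = ?t k (SOME x. x \<in> carrier ?N \<and> x k = m)" for k m
  define g where "g k X = (SOME x. x \<in> carrier ?N \<and> ?t k x = X) k" for k X
  have f: "f k (x k) = ?t k x" if x: "x \<in> carrier ?N" for k x
  proof -
    have "\<exists>y. y \<in> carrier ?N \<and> y k = x k" using x by blast
    from someI_ex[OF this] show ?thesis unfolding f_def using t_eq x by blast
  qed
  have g: "g k (?t k x) = x k" if x: "x \<in> carrier ?N" for k x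
  proof -
    have "\<exists>y. y \<in> carrier ?N \<and> ?t k y = ?t k x" using x by blast
    from someI_ex[OF this] show ?thesis unfolding g_def using t_eq x by blast
  qed
  let ?C = "induced_system R I ?N"
  have C: "carrier (?C k) = ?t k ` carrier ?N" for k
    unfolding induced_system_def by (rule B.carrier_base_change)
  have C_add: "?t k x \<oplus>\<^bsub>?C k\<^esub> ?t k y = ?t k (x \<oplus>\<^bsub>?N\<^esub> y)"
    if "x \<in> carrier ?N" "y \<in> carrier ?N" for k x y
    unfolding induced_system_def by (rule B.one_tensor_add[OF that])
  have C_smult: "adic_proj R I k r \<odot>\<^bsub>?C k\<^esub> ?t k x = ?t k (r \<odot>\<^bsub>?N\<^esub> x)"
    if "r \<in> carrier R" "x \<in> carrier ?N" for k r x
    unfolding induced_system_def by (rule B.one_tensor_smult[OF that])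
  have C_trans: "induced_trans R I ?N k (?t (Suc k) x) = ?t k x" if x: "x \<in> carrier ?N" for k x
  proof -
    have hom: "adic_ring_trans R I k \<in> module_hom R (B.RS (Suc k)) (B.RS k)"
    proof -
      note h = R.adic_ring_trans_ring_hom[OF assms(2), of k]
      show ?thesis
        using ring_hom_closed[OF h] ring_hom_add[OF h] ring_hom_mult[OF h]
          R.adic_ring_trans_proj[OF assms(2)]
        by (auto simp: module_hom_def hom_def)
    qed
    show ?thesis
      unfolding induced_trans_def
      by (subst B.tensor_map_one_tensor[OF T.module_limit B.module_RS hom B.id_module_hom x])
        (simp add: B.one_tensor_def ring_hom_one[OF R.adic_ring_trans_ring_hom[OF assms(2)]])
  qed
  \<comment> \<open>Every element of either side is now given by some \<open>x\<close> in \<open>N\<close>, so linearity and compatibility with the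
    transitions are inherited from \<open>N\<close>.\<close>
  have lift_M: "\<exists>x\<in>carrier ?N. m = x k" if "m \<in> carrier (M k)" for m k
    using T.component_surj[of m k] that by auto
  have N_add: "(x \<oplus>\<^bsub>?N\<^esub> y) k = x k \<oplus>\<^bsub>M k\<^esub> y k" for x y k by simp
  have N_smult: "(r \<odot>\<^bsub>?N\<^esub> x) k = adic_proj R I k r \<odot>\<^bsub>M k\<^esub> x k" for r x k by simp
  have comp: "x k \<in> carrier (M k)" if "x \<in> carrier ?N" for x k
    using T.limit_component[OF that, of k] by simp
  have "adic_morphism R I M \<tau> ?C (induced_trans R I ?N) f"
    unfolding adic_morphism_def module_hom_def
  proof (intro allI conjI ballI CollectI homI)
    fix k m assume "m \<in> carrier (M (Suc k))"
    then obtain x where x: "x \<in> carrier ?N" "m = x (Suc k)" using lift_M by blast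
    then show "f k (\<tau> k m) = induced_trans R I ?N k (f (Suc k) m)"
      using f C_trans T.limit_compatible by simp
  next
    fix k m assume "m \<in> carrier (add_monoid (?L k))"
    then obtain x where x: "x \<in> carrier ?N" "m = x k" using lift_M by auto
    then show "f k m \<in> carrier (add_monoid (restrict_scalars (adic_proj R I k) (?C k)))"
      using f C by simp
  next
    fix k m m' assume "m \<in> carrier (add_monoid (?L k))" "m' \<in> carrier (add_monoid (?L k))"
    then have "m \<in> carrier (M k)" "m' \<in> carrier (M k)" by simp_all
    then obtain x y where x: "x \<in> carrier ?N" "m = x k" and y: "y \<in> carrier ?N" "m' = y k"
      using lift_M by blast
    have "f k (x k \<oplus>\<^bsub>M k\<^esub> y k) = ?t k (x \<oplus>\<^bsub>?N\<^esub> y)"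
      using f[OF T.N.M.a_closed[OF x(1) y(1)], of k] N_add by simp
    then show "f k (m \<otimes>\<^bsub>add_monoid (?L k)\<^esub> m') =
        f k m \<otimes>\<^bsub>add_monoid (restrict_scalars (adic_proj R I k) (?C k))\<^esub> f k m'"
      using x y f C_add by simp
  next
    fix k r m assume r: "r \<in> carrier R" and "m \<in> carrier (?L k)"
    then obtain x where x: "x \<in> carrier ?N" "m = x k" using lift_M by auto
    have "f k (adic_proj R I k r \<odot>\<^bsub>M k\<^esub> x k) = ?t k (r \<odot>\<^bsub>?N\<^esub> x)"
      using f[OF T.N.smult_closed[OF r x(1)], of k] N_smult by simp
    then show "f k (r \<odot>\<^bsub>?L k\<^esub> m) = r \<odot>\<^bsub>restrict_scalars (adic_proj R I k) (?C k)\<^esub> f k m"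
      using x r f C_smult by simp
  qed
  moreover have "adic_morphism R I ?C (induced_trans R I ?N) M \<tau> g"
    unfolding adic_morphism_def module_hom_def
  proof (intro allI conjI ballI CollectI homI)
    fix k X assume "X \<in> carrier (?C (Suc k))"
    then obtain x where x: "x \<in> carrier ?N" "X = ?t (Suc k) x" using C by blast
    then show "g k (induced_trans R I ?N k X) = \<tau> k (g (Suc k) X)"
      using g C_trans T.limit_compatible by simp
  next
    fix k X assume "X \<in> carrier (add_monoid (restrict_scalars (adic_proj R I k) (?C k)))"
    then obtain x where x: "x \<in> carrier ?N" "X = ?t k x" using C by auto
    then show "g k X \<in> carrier (add_monoid (?L k))"
      using g comp by simp
  next
    fix k X Y assume "X \<in> carrier (add_monoid (restrict_scalars (adic_proj R I k) (?C k)))"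
      "Y \<in> carrier (add_monoid (restrict_scalars (adic_proj R I k) (?C k)))"
    then obtain x y where x: "x \<in> carrier ?N" "X = ?t k x" and y: "y \<in> carrier ?N" "Y = ?t k y"
      using C by auto
    have "g k (?t k (x \<oplus>\<^bsub>?N\<^esub> y)) = x k \<oplus>\<^bsub>M k\<^esub> y k"
      using g[OF T.N.M.a_closed[OF x(1) y(1)], of k] N_add by simp
    then show "g k (X \<otimes>\<^bsub>add_monoid (restrict_scalars (adic_proj R I k) (?C k))\<^esub> Y) =
        g k X \<otimes>\<^bsub>add_monoid (?L k)\<^esub> g k Y"
      using x y g C_add by simp
  next
    fix k r X assume r: "r \<in> carrier R" and "X \<in> carrier (restrict_scalars (adic_proj R I k) (?C k))"
    then obtain x where x: "x \<in> carrier ?N" "X = ?t k x" using C by auto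
    have "g k (?t k (r \<odot>\<^bsub>?N\<^esub> x)) = adic_proj R I k r \<odot>\<^bsub>M k\<^esub> x k"
      using g[OF T.N.smult_closed[OF r x(1)], of k] N_smult by simp
    then show "g k (r \<odot>\<^bsub>restrict_scalars (adic_proj R I k) (?C k)\<^esub> X) = r \<odot>\<^bsub>?L k\<^esub> g k X"
      using x r g C_smult by simp
  qed
  moreover have "g k (f k m) = m" if "m \<in> carrier (M k)" for k m
    using lift_M[OF that] f g by auto
  moreover have "f k (g k X) = X" if "X \<in> carrier (?C k)" for k X
    using that C f g by auto
  ultimately have "adic_isomorphic R I M \<tau> ?C (induced_trans R I ?N)"
    unfolding adic_isomorphic_def by blast
  then show ?thesis using T.module_limit by blast
qed

end
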